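(* Let $(R,\mathfrak m)$ be a commutative Noetherian local ring and let $M$ be a finitely generated $R$-module of dimension $d\ge 1$. Let $N$ be a submodule of $M$ with $\operatorname{depth}(M/N)\ge d-1$. Then for any ideal $\mathfrak q$ of $R$ that is generated by a system of parameters on $M$, $\ell(N/\mathfrak qN)\le \ell(M/\mathfrak qM)$.
   Context: All rings are commutative Noetherian with non-zero identity. $\ell(K)$ denotes the length of an $R$-module $K$. For a finitely generated $R$-module $M$ of dimension $d$ over a local ring $(R,\mathfrak m)$, a system of parameters on $M$ is a sequence $x_1,\dots,x_d\in\mathfrak m$ such that $M/(x_1,\dots,x_d)M$ has finite length. *)

theory Defs
  imports "HOL-Algebra.Module" "HOL-Algebra.QuotRing" "HOL-Algebra.Ring_Divisibility"
    "HOL-Library.Extended_Nat"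
begin

locale local_ring = maximalideal \<mm> R + cring R for \<mm> and R (structure) +
  assumes maximal_unique: "maximalideal I R \<Longrightarrow> I = \<mm>"


section \<open>Submodules and quotient modules\<close>

definition submodule_span ::
    "('a, 'r) ring_scheme \<Rightarrow> ('a, 'b, 'm) module_scheme \<Rightarrow> 'b set \<Rightarrow> 'b set"
  where "submodule_span R M S = \<Inter> {H. submodule H R M \<and> S \<subseteq> H}"

definition finitely_generated_module ::
    "('a, 'r) ring_scheme \<Rightarrow> ('a, 'b, 'm) module_scheme \<Rightarrow> bool"
  where "finitely_generated_module R M \<longleftrightarrow>
    (\<exists>S \<subseteq> carrier M. finite S \<and> submodule_span R M S = carrier M)"

definition ideal_smult ::
    "('a, 'r) ring_scheme \<Rightarrow> 'a set \<Rightarrow> ('a, 'b, 'm) module_scheme \<Rightarrow> 'b set"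
  where "ideal_smult R I M = submodule_span R M {a \<odot>\<^bsub>M\<^esub> x | a x. a \<in> I \<and> x \<in> carrier M}"

text \<open>
  The record \<open>module\<close> inherits the fields \<open>mult\<close> and \<open>one\<close> from \<open>ring\<close>, but the locale
  \<open>module\<close> does not constrain them. A submodule \<open>N\<close> of \<open>M\<close>, regarded as a module itself,
  is \<open>M\<lparr>carrier := N\<rparr>\<close>.
\<close>

definition quotient_module ::
    "('a, 'b, 'm) module_scheme \<Rightarrow> 'b set \<Rightarrow> ('a, 'b set) module"
  where "quotient_module M N =
    \<lparr>carrier = a_rcosets\<^bsub>M\<^esub> N, monoid.mult = undefined, monoid.one = undefined, ring.zero = N, ring.add = set_add M,
     module.smult = (\<lambda>a B. \<Union>x\<in>B. N +>\<^bsub>M\<^esub> (a \<odot>\<^bsub>M\<^esub> x))\<rparr>"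

lemma (in module) quotient_abelian_subgroup:
  assumes "submodule N R M"
  shows "abelian_subgroup N M"
  using submodule.axioms(1)[OF assms] M.abelian_group_axioms
  by (intro abelian_subgroupI3 additive_subgroup.intro)

lemma (in module) quotient_smult_coset:
  assumes N: "submodule N R M" and a: "a \<in> carrier R" and x: "x \<in> carrier M"
  shows "a \<odot>\<^bsub>quotient_module M N\<^esub> (N +>\<^bsub>M\<^esub> x) = N +>\<^bsub>M\<^esub> (a \<odot>\<^bsub>M\<^esub> x)"
proof -
  interpret N: abelian_subgroup N M
    by (rule quotient_abelian_subgroup[OF N])
  have *: "N +>\<^bsub>M\<^esub> (a \<odot>\<^bsub>M\<^esub> y) = N +>\<^bsub>M\<^esub> (a \<odot>\<^bsub>M\<^esub> x)" if y: "y \<in> N +>\<^bsub>M\<^esub> x" for y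
  proof -
    obtain n where n: "n \<in> N" "y = n \<oplus>\<^bsub>M\<^esub> x"
      using y by (auto simp: a_r_coset_def')
    have an: "a \<odot>\<^bsub>M\<^esub> n \<in> N"
      using N a n by (simp add: submodule.smult_closed)
    have "a \<odot>\<^bsub>M\<^esub> y = a \<odot>\<^bsub>M\<^esub> n \<oplus>\<^bsub>M\<^esub> a \<odot>\<^bsub>M\<^esub> x"
      using n a x N.a_subset by (simp add: smult_r_distr subsetD)
    then have "a \<odot>\<^bsub>M\<^esub> y \<in> N +>\<^bsub>M\<^esub> (a \<odot>\<^bsub>M\<^esub> x)"
      using an by (auto simp: a_r_coset_def')
    then show ?thesis
      using N.a_repr_independence'[OF _ smult_closed[OF a x]] by simp
  qed
  have "(\<Union>y\<in>N +>\<^bsub>M\<^esub> x. N +>\<^bsub>M\<^esub> (a \<odot>\<^bsub>M\<^esub> y)) = N +>\<^bsub>M\<^esub> (a \<odot>\<^bsub>M\<^esub> x)"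
    by (rule UN_constant_eq[OF N.a_rcos_self[OF x]]) (use * in blast)
  then show ?thesis
    by (simp only: quotient_module_def module.simps)
qed

lemma (in module) quotient_module_is_module:
  assumes N: "submodule N R M"
  shows "module R (quotient_module M N)"
proof -
  interpret N: abelian_subgroup N M
    by (rule quotient_abelian_subgroup[OF N])
  have carr: "carrier (quotient_module M N) = {N +>\<^bsub>M\<^esub> x | x. x \<in> carrier M}"
    by (auto simp: quotient_module_def A_RCOSETS_def')
  have add: "(N +>\<^bsub>M\<^esub> x) \<oplus>\<^bsub>quotient_module M N\<^esub> (N +>\<^bsub>M\<^esub> y) = N +>\<^bsub>M\<^esub> (x \<oplus>\<^bsub>M\<^esub> y)"
    if "x \<in> carrier M" "y \<in> carrier M" for x y
    using N.a_rcos_sum that by (simp add: quotient_module_def)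
  have zero: "\<zero>\<^bsub>quotient_module M N\<^esub> = N +>\<^bsub>M\<^esub> \<zero>\<^bsub>M\<^esub>"
    by (simp add: quotient_module_def N.a_subset)
  let ?Q = "quotient_module M N"
  note rules = add quotient_smult_coset[OF N]
  have cosetE: "\<exists>x\<in>carrier M. A = N +>\<^bsub>M\<^esub> x" if "A \<in> carrier ?Q" for A
    using that by (auto simp: carr)
  have cosetI: "N +>\<^bsub>M\<^esub> x \<in> carrier ?Q" if "x \<in> carrier M" for x
    using that by (auto simp: carr)
  show ?thesis
  proof (rule moduleI)
    show "cring R" ..
    show "abelian_group ?Q"
    proof (rule abelian_groupI)
      show "A \<oplus>\<^bsub>?Q\<^esub> B \<in> carrier ?Q" if "A \<in> carrier ?Q" "B \<in> carrier ?Q" for A B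
        using cosetE[OF that(1)] cosetE[OF that(2)] by (auto simp: add cosetI)
      show "\<zero>\<^bsub>?Q\<^esub> \<in> carrier ?Q"
        unfolding zero by (simp add: cosetI)
      show "A \<oplus>\<^bsub>?Q\<^esub> B \<oplus>\<^bsub>?Q\<^esub> C = A \<oplus>\<^bsub>?Q\<^esub> (B \<oplus>\<^bsub>?Q\<^esub> C)"
        if "A \<in> carrier ?Q" "B \<in> carrier ?Q" "C \<in> carrier ?Q" for A B C
        using cosetE[OF that(1)] cosetE[OF that(2)] cosetE[OF that(3)]
        by (auto simp: add M.a_assoc)
      show "A \<oplus>\<^bsub>?Q\<^esub> B = B \<oplus>\<^bsub>?Q\<^esub> A" if "A \<in> carrier ?Q" "B \<in> carrier ?Q" for A B
        using cosetE[OF that(1)] cosetE[OF that(2)] by (auto simp: add M.a_comm)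
      show "\<zero>\<^bsub>?Q\<^esub> \<oplus>\<^bsub>?Q\<^esub> A = A" if "A \<in> carrier ?Q" for A
        using cosetE[OF that] unfolding zero by (auto simp: add)
      show "\<exists>B\<in>carrier ?Q. B \<oplus>\<^bsub>?Q\<^esub> A = \<zero>\<^bsub>?Q\<^esub>" if A: "A \<in> carrier ?Q" for A
      proof -
        obtain x where x: "x \<in> carrier M" "A = N +>\<^bsub>M\<^esub> x"
          using cosetE[OF A] by blast
        then have "(N +>\<^bsub>M\<^esub> (\<ominus>\<^bsub>M\<^esub> x)) \<oplus>\<^bsub>?Q\<^esub> A = \<zero>\<^bsub>?Q\<^esub>"
          unfolding zero by (simp add: add M.l_neg)
        moreover have "N +>\<^bsub>M\<^esub> (\<ominus>\<^bsub>M\<^esub> x) \<in> carrier ?Q"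
          using x by (simp add: cosetI)
        ultimately show ?thesis ..
      qed
    qed
    fix a A assume a: "a \<in> carrier R" and A: "A \<in> carrier ?Q"
    obtain x where x: "x \<in> carrier M" "A = N +>\<^bsub>M\<^esub> x"
      using cosetE[OF A] by blast
    show "a \<odot>\<^bsub>?Q\<^esub> A \<in> carrier ?Q"
      using a x by (simp add: rules cosetI)
    show "(a \<oplus>\<^bsub>R\<^esub> b) \<odot>\<^bsub>?Q\<^esub> A = a \<odot>\<^bsub>?Q\<^esub> A \<oplus>\<^bsub>?Q\<^esub> b \<odot>\<^bsub>?Q\<^esub> A" if "b \<in> carrier R" for b
      using a x that by (simp add: rules smult_l_distr)
    show "(a \<otimes>\<^bsub>R\<^esub> b) \<odot>\<^bsub>?Q\<^esub> A = a \<odot>\<^bsub>?Q\<^esub> (b \<odot>\<^bsub>?Q\<^esub> A)" if "b \<in> carrier R" for b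
      using a x that by (simp add: rules smult_assoc1)
    show "a \<odot>\<^bsub>?Q\<^esub> (A \<oplus>\<^bsub>?Q\<^esub> B) = a \<odot>\<^bsub>?Q\<^esub> A \<oplus>\<^bsub>?Q\<^esub> a \<odot>\<^bsub>?Q\<^esub> B" if "B \<in> carrier ?Q" for B
      using a x cosetE[OF that] by (auto simp: rules smult_r_distr)
  next
    show "\<one>\<^bsub>R\<^esub> \<odot>\<^bsub>?Q\<^esub> A = A" if "A \<in> carrier ?Q" for A
      using cosetE[OF that] by (auto simp: rules)
  qed
qed


section \<open>Length and dimension\<close>

definition module_length ::
    "('a, 'r) ring_scheme \<Rightarrow> ('a, 'b, 'm) module_scheme \<Rightarrow> enat"
  where "module_length R M = Sup {enat n | n.
    \<exists>C. (\<forall>i\<le>n. submodule (C i) R M) \<and> (\<forall>i<n. C i \<subset> C (Suc i))}"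

text \<open>The zero ring and the zero module get dimension \<open>0\<close> here, not \<open>- \<infinity>\<close>.\<close>

definition krull_dim :: "('a, 'r) ring_scheme \<Rightarrow> enat"
  where "krull_dim R = Sup {enat n | n.
    \<exists>P. (\<forall>i\<le>n. primeideal (P i) R) \<and> (\<forall>i<n. P i \<subset> P (Suc i))}"

definition annihilator ::
    "('a, 'r) ring_scheme \<Rightarrow> ('a, 'b, 'm) module_scheme \<Rightarrow> 'a set"
  where "annihilator R M = {a \<in> carrier R. \<forall>x\<in>carrier M. a \<odot>\<^bsub>M\<^esub> x = \<zero>\<^bsub>M\<^esub>}"

definition module_dim ::
    "('a, 'r) ring_scheme \<Rightarrow> ('a, 'b, 'm) module_scheme \<Rightarrow> enat"
  where "module_dim R M = krull_dim (R Quot (annihilator R M))"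


section \<open>Depth and systems of parameters\<close>

definition regular_sequence ::
    "('a, 'r) ring_scheme \<Rightarrow> ('a, 'b, 'm) module_scheme \<Rightarrow> 'a list \<Rightarrow> bool"
  where "regular_sequence R M xs \<longleftrightarrow>
    set xs \<subseteq> carrier R \<and>
    (\<forall>i<length xs.
      let Q = quotient_module M (ideal_smult R (Idl\<^bsub>R\<^esub> (set (take i xs))) M)
      in \<forall>z\<in>carrier Q. (xs ! i) \<odot>\<^bsub>Q\<^esub> z = \<zero>\<^bsub>Q\<^esub> \<longrightarrow> z = \<zero>\<^bsub>Q\<^esub>) \<and>
    ideal_smult R (Idl\<^bsub>R\<^esub> (set xs)) M \<noteq> carrier M"

text \<open>
  The depth of \<open>M\<close> over a local ring with maximal ideal \<open>I\<close>. In particular the zero module has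
  depth \<open>\<infinity>\<close>; without the case distinction it would get \<open>Sup {} = 0\<close>.
\<close>

definition depth ::
    "('a, 'r) ring_scheme \<Rightarrow> 'a set \<Rightarrow> ('a, 'b, 'm) module_scheme \<Rightarrow> enat"
  where "depth R I M =
    (if ideal_smult R I M = carrier M then \<infinity>
     else Sup {enat (length xs) | xs. set xs \<subseteq> I \<and> regular_sequence R M xs})"

definition system_of_parameters ::
    "('a, 'r) ring_scheme \<Rightarrow> 'a set \<Rightarrow> ('a, 'b, 'm) module_scheme \<Rightarrow> 'a list \<Rightarrow> bool"
  where "system_of_parameters R \<mm> M xs \<longleftrightarrow>
    set xs \<subseteq> \<mm> \<and> enat (length xs) = module_dim R M \<and>
    module_length R (quotient_module M (ideal_smult R (Idl\<^bsub>R\<^esub> (set xs)) M)) < \<infinity>"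

end

theory Submission
  imports Defs
begin

text \<open>
Put \<open>L = M/N\<close>. If an element \<open>y\<close> is regular on \<open>L\<close>, then \<open>N \<inter> yM = yN\<close>, so that \<open>N/yN\<close> embeds
into \<open>M/yM\<close> with cokernel \<open>L/yL\<close>: the inequality for \<open>N \<subseteq> M\<close> and \<open>(y, \<dots>)\<close> follows from the inequality
for \<open>N/yN \<subseteq> M/yM\<close> and the remaining parameters. So it suffices to generate \<open>\<qq>\<close> by elements
\<open>y\<^sub>1, \<dots>, y\<^sub>d\<close> such that \<open>y\<^sub>1, \<dots>, y\<^bsub>d - 1\<^esub>\<close> is a regular sequence on \<open>L\<close>; then only the case of a
single parameter is left.

A single parameter \<open>x\<close> (\<open>length_mod_one_parameter\<close>). If \<open>xM \<subseteq> N\<close> and \<open>M/xM\<close> has finite length, then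
\<open>\<ell>(M/N) + \<ell>(N/xN) = \<ell>(M/xN) = \<ell>(M/xM) + \<ell>(xM/xN)\<close>, and \<open>xM/xN\<close> is a quotient of \<open>M/N\<close>, whose length is
finite; hence \<open>\<ell>(N/xN) \<le> \<ell>(M/xM)\<close>. Applied to \<open>N\<close> inside \<open>N : x\<close>, then to \<open>N : x\<close> inside \<open>N : x\<^sup>2\<close>, and so
on, this reduces the claim to a submodule \<open>N = N : x\<close>, for which \<open>x\<close> is regular on \<open>M/N\<close> and \<open>N/xN\<close>
embeds into \<open>M/xM\<close>.

The regular elements. The elements that are not regular on a Noetherian module form a finite union of primes, each
of them the annihilator of a nonzero element. If no nonzero element of \<open>L\<close> is killed by
\<open>\<qq> = (z\<^sub>1, \<dots>, z\<^sub>d)\<close>, then prime avoidance yields a regular element \<open>y = z\<^sub>1 + c\<close> with \<open>c\<close> in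
\<open>(z\<^sub>2, \<dots>, z\<^sub>d)\<close>, and \<open>z\<^sub>1\<close> may be replaced by \<open>y\<close> (\<open>ex_regular_in_coset\<close>). Two facts make sure that
this can be repeated \<open>d - 1\<close> times. First, the depth of \<open>L/yL\<close> is one less than that of \<open>L\<close> whatever
regular element \<open>y\<close> of \<open>\<mm>\<close> is taken (\<open>deep_of_regular\<close>). Secondly, as \<open>M/\<qq>M\<close> has finite
length, a prime that contains \<open>\<qq>\<close> and is the annihilator of an element of \<open>L\<close> is equal to \<open>\<mm>\<close>, so an
element killed by \<open>\<qq>\<close> gives one killed by \<open>\<mm>\<close> (\<open>no_socle_of_finite_length\<close>, by Nakayama's lemma at a
prime). If \<open>M/\<qq>M\<close> has infinite length, there is nothing to prove.

The induction changes the module at each step. To stay within one module, a quotient \<open>M/K\<close>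
is represented throughout by the submodule \<open>K\<close>, and the length of \<open>B/A\<close> by the supremum of the lengths of
chains of submodules between \<open>A\<close> and \<open>B\<close>.
\<close>

section \<open>Sums and multiples of submodules\<close>

context module
begin

abbreviation sub :: "'c set \<Rightarrow> bool"
  where "sub K \<equiv> submodule K R M"

abbreviation sub_sum :: "'c set \<Rightarrow> 'c set \<Rightarrow> 'c set"  (infixl "+\<^sub>M" 65)
  where "A +\<^sub>M B \<equiv> A <+>\<^bsub>M\<^esub> B"

abbreviation multiple :: "'a \<Rightarrow> 'c set \<Rightarrow> 'c set"  (infixr "\<cdot>" 75)
  where "x \<cdot> A \<equiv> (\<lambda>m. x \<odot>\<^bsub>M\<^esub> m) ` A"

lemma subD:
  assumes "sub K"
  shows "K \<subseteq> carrier M"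
    and "\<And>x. x \<in> K \<Longrightarrow> x \<in> carrier M"
    and "\<zero>\<^bsub>M\<^esub> \<in> K"
    and "\<And>x. x \<in> K \<Longrightarrow> \<ominus>\<^bsub>M\<^esub> x \<in> K"
    and "\<And>x y. x \<in> K \<Longrightarrow> y \<in> K \<Longrightarrow> x \<oplus>\<^bsub>M\<^esub> y \<in> K"
    and "\<And>a x. a \<in> carrier R \<Longrightarrow> x \<in> K \<Longrightarrow> a \<odot>\<^bsub>M\<^esub> x \<in> K"
  using submoduleE[OF assms] subgroup.one_closed[OF submodule.axioms(1)[OF assms]] by auto

lemma smult_left_commute:
  assumes "a \<in> carrier R" "b \<in> carrier R" "x \<in> carrier M"
  shows "a \<odot>\<^bsub>M\<^esub> (b \<odot>\<^bsub>M\<^esub> x) = b \<odot>\<^bsub>M\<^esub> (a \<odot>\<^bsub>M\<^esub> x)"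
  using assms by (metis smult_assoc1 R.m_comm)

lemma mem_sum_iff: "x \<in> A +\<^sub>M B \<longleftrightarrow> (\<exists>a\<in>A. \<exists>b\<in>B. x = a \<oplus>\<^bsub>M\<^esub> b)"
  by (auto simp: set_add_def')

lemma mem_sumE:
  assumes "x \<in> A +\<^sub>M B"
  obtains a b where "a \<in> A" "b \<in> B" "x = a \<oplus>\<^bsub>M\<^esub> b"
  using assms unfolding mem_sum_iff by blast

lemma sum_memI: "a \<in> A \<Longrightarrow> b \<in> B \<Longrightarrow> a \<oplus>\<^bsub>M\<^esub> b \<in> A +\<^sub>M B"
  by (auto simp: set_add_def')

lemma sub_sum_closed:
  assumes A: "sub A" and B: "sub B"
  shows "sub (A +\<^sub>M B)"
proof (rule submoduleI)
  note cl = subD(2)[OF A] subD(2)[OF B]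
  show "A +\<^sub>M B \<subseteq> carrier M"
    using cl by (auto simp: mem_sum_iff)
  show "\<zero>\<^bsub>M\<^esub> \<in> A +\<^sub>M B"
    using sum_memI[OF subD(3)[OF A] subD(3)[OF B]] by simp
  show "\<ominus>\<^bsub>M\<^esub> x \<in> A +\<^sub>M B" if xs: "x \<in> A +\<^sub>M B" for x
  proof -
    obtain a b where ab: "a \<in> A" "b \<in> B" "x = a \<oplus>\<^bsub>M\<^esub> b"
      using xs by (rule mem_sumE)
    then have "\<ominus>\<^bsub>M\<^esub> x = \<ominus>\<^bsub>M\<^esub> a \<oplus>\<^bsub>M\<^esub> \<ominus>\<^bsub>M\<^esub> b"
      using cl by (simp add: M.minus_add)
    then show ?thesis
      using sum_memI[OF subD(4)[OF A ab(1)] subD(4)[OF B ab(2)]] by simp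
  qed
  show "x \<oplus>\<^bsub>M\<^esub> y \<in> A +\<^sub>M B" if xy: "x \<in> A +\<^sub>M B" "y \<in> A +\<^sub>M B" for x y
  proof -
    obtain a b where ab: "a \<in> A" "b \<in> B" "x = a \<oplus>\<^bsub>M\<^esub> b"
      using xy(1) by (rule mem_sumE)
    obtain c d where cd: "c \<in> A" "d \<in> B" "y = c \<oplus>\<^bsub>M\<^esub> d"
      using xy(2) by (rule mem_sumE)
    have "x \<oplus>\<^bsub>M\<^esub> y = (a \<oplus>\<^bsub>M\<^esub> c) \<oplus>\<^bsub>M\<^esub> (b \<oplus>\<^bsub>M\<^esub> d)"
      using ab cd cl by (simp add: M.a_ac)
    then show ?thesis
      using sum_memI[OF subD(5)[OF A ab(1) cd(1)] subD(5)[OF B ab(2) cd(2)]] by simp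
  qed
  show "r \<odot>\<^bsub>M\<^esub> x \<in> A +\<^sub>M B" if r: "r \<in> carrier R" and x: "x \<in> A +\<^sub>M B" for r x
  proof -
    obtain a b where ab: "a \<in> A" "b \<in> B" "x = a \<oplus>\<^bsub>M\<^esub> b"
      using x by (rule mem_sumE)
    then have "r \<odot>\<^bsub>M\<^esub> x = r \<odot>\<^bsub>M\<^esub> a \<oplus>\<^bsub>M\<^esub> r \<odot>\<^bsub>M\<^esub> b"
      using cl r by (simp add: smult_r_distr)
    then show ?thesis
      using sum_memI[OF subD(6)[OF A r ab(1)] subD(6)[OF B r ab(2)]] by simp
  qed
qed

lemma multiple_sub:
  assumes x: "x \<in> carrier R" and A: "sub A"
  shows "sub (x \<cdot> A)"
proof (rule submoduleI)
  note cl = subD(2)[OF A]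
  show "x \<cdot> A \<subseteq> carrier M"
    using cl x by auto
  show "\<zero>\<^bsub>M\<^esub> \<in> x \<cdot> A"
    using subD(3)[OF A] x by (metis image_eqI smult_r_null)
  show "\<ominus>\<^bsub>M\<^esub> y \<in> x \<cdot> A" if "y \<in> x \<cdot> A" for y
    using that cl x subD(4)[OF A] by (auto simp flip: smult_r_minus)
  show "y \<oplus>\<^bsub>M\<^esub> z \<in> x \<cdot> A" if yz: "y \<in> x \<cdot> A" "z \<in> x \<cdot> A" for y z
    using yz cl x subD(5)[OF A] by (auto simp flip: smult_r_distr)
  show "r \<odot>\<^bsub>M\<^esub> y \<in> x \<cdot> A" if r: "r \<in> carrier R" and y: "y \<in> x \<cdot> A" for r y
    using y r cl x subD(6)[OF A] by (auto simp: smult_left_commute[OF r x])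
qed

lemma inter_sub:
  assumes A: "sub A" and B: "sub B"
  shows "sub (A \<inter> B)"
  by (rule submoduleI) (use subD[OF A] subD[OF B] in auto)

lemma sum_upper1: "sub A \<Longrightarrow> sub B \<Longrightarrow> A \<subseteq> A +\<^sub>M B"
  using sum_memI[OF _ subD(3), of _ A B] by (auto dest: subD(2)) (metis M.r_zero subD(2))

lemma sum_upper2: "sub A \<Longrightarrow> sub B \<Longrightarrow> B \<subseteq> A +\<^sub>M B"
  using sum_memI[OF subD(3), of A _ B] by (auto dest: subD(2)) (metis M.l_zero subD(2))

lemma sum_least: "sub C \<Longrightarrow> A \<subseteq> C \<Longrightarrow> B \<subseteq> C \<Longrightarrow> A +\<^sub>M B \<subseteq> C"
  by (auto elim!: mem_sumE intro: subD(5))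

lemma sum_mono: "A \<subseteq> A' \<Longrightarrow> B \<subseteq> B' \<Longrightarrow> A +\<^sub>M B \<subseteq> A' +\<^sub>M B'"
  by (auto elim!: mem_sumE intro!: sum_memI)

lemma sum_commute: "sub A \<Longrightarrow> sub B \<Longrightarrow> A +\<^sub>M B = B +\<^sub>M A"
  by (intro subset_antisym sum_least sub_sum_closed sum_upper1 sum_upper2)

lemma sum_assoc: "sub A \<Longrightarrow> sub B \<Longrightarrow> sub C \<Longrightarrow> A +\<^sub>M B +\<^sub>M C = A +\<^sub>M (B +\<^sub>M C)"
  by (meson subset_antisym sum_least sub_sum_closed sum_upper1 sum_upper2 order_trans)

lemma sum_absorb: "sub A \<Longrightarrow> sub B \<Longrightarrow> B \<subseteq> A \<Longrightarrow> A +\<^sub>M B = A"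
  by (intro subset_antisym sum_least sum_upper1) auto

lemma multiple_subset: "x \<in> carrier R \<Longrightarrow> sub A \<Longrightarrow> x \<cdot> A \<subseteq> A"
  by (auto dest: subD(6))

lemma add_mem_cancel:
  assumes K: "sub K" and k: "k \<in> K" and x: "x \<in> carrier M" and kx: "k \<oplus>\<^bsub>M\<^esub> x \<in> K"
  shows "x \<in> K"
proof -
  have "x = \<ominus>\<^bsub>M\<^esub> k \<oplus>\<^bsub>M\<^esub> (k \<oplus>\<^bsub>M\<^esub> x)"
    using x subD(2)[OF K k] by (simp add: M.r_neg1)
  then show ?thesis
    using subD(5)[OF K subD(4)[OF K k] kx] by simp
qed

lemma modular_law:
  assumes A: "sub A" and B: "sub B" and C: "sub C" and AC: "A \<subseteq> C"
  shows "(A +\<^sub>M B) \<inter> C = A +\<^sub>M (B \<inter> C)"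
proof (intro equalityI subsetI)
  fix x assume "x \<in> (A +\<^sub>M B) \<inter> C"
  then obtain a b where ab: "a \<in> A" "b \<in> B" "x = a \<oplus>\<^bsub>M\<^esub> b" "x \<in> C"
    by (auto simp: mem_sum_iff)
  then have "b \<in> C"
    using add_mem_cancel[OF C, of a b] AC subD(2)[OF B] by auto
  then show "x \<in> A +\<^sub>M (B \<inter> C)"
    using ab by (auto intro: sum_memI)
next
  fix x assume "x \<in> A +\<^sub>M (B \<inter> C)"
  then show "x \<in> (A +\<^sub>M B) \<inter> C"
    using AC subD(5)[OF C] by (auto simp: mem_sum_iff)
qed

text \<open>
What makes length additive: by the modular law a proper inclusion \<open>A \<subset> C\<close> stays proper after intersecting
with \<open>B\<close> or after adding \<open>B\<close>.
\<close>

lemma eq_of_inter_sum_eq: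
  assumes A: "sub A" and B: "sub B" and C: "sub C" and AC: "A \<subseteq> C"
    and "A \<inter> B = C \<inter> B" and "A +\<^sub>M B = C +\<^sub>M B"
  shows "A = C"
proof -
  have "C = (C +\<^sub>M B) \<inter> C"
    using sum_upper1[OF C B] by auto
  also have "\<dots> = A +\<^sub>M (B \<inter> C)"
    using modular_law[OF A B C AC] assms(6) by simp
  also have "\<dots> = A"
    using assms(5) by (intro sum_absorb A inter_sub B C) auto
  finally show ?thesis ..
qed

lemma diff_mem:
  assumes K: "sub K" and p: "p \<in> K" and q: "q \<in> K" and u: "u \<in> carrier M" and v: "v \<in> carrier M"
    and eq: "p \<oplus>\<^bsub>M\<^esub> u = q \<oplus>\<^bsub>M\<^esub> v"
  shows "v \<ominus>\<^bsub>M\<^esub> u \<in> K"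
proof -
  have pq: "p \<in> carrier M" "q \<in> carrier M"
    using p q subD(2)[OF K] by auto
  have "v \<ominus>\<^bsub>M\<^esub> u = \<ominus>\<^bsub>M\<^esub> q \<oplus>\<^bsub>M\<^esub> (q \<oplus>\<^bsub>M\<^esub> v) \<ominus>\<^bsub>M\<^esub> u"
    using u v pq by (simp add: M.r_neg1)
  also have "\<dots> = \<ominus>\<^bsub>M\<^esub> q \<oplus>\<^bsub>M\<^esub> p"
    unfolding eq[symmetric] using u v pq by (simp add: M.minus_eq M.a_assoc M.r_neg)
  finally show ?thesis
    using subD(4)[OF K q] subD(5)[OF K] p by simp
qed

end


section \<open>Length of intervals of submodules\<close>

text \<open>
Submodules \<open>C 0 \<subset> \<dots> \<subset> C n\<close> between \<open>A\<close> and \<open>B\<close>: this is a chain of length \<open>n\<close> in \<open>B/A\<close> when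
\<open>A\<close> and \<open>B\<close> are submodules. The ends of the chain need not be \<open>A\<close> and \<open>B\<close>, so \<open>A = {}\<close> and \<open>B = UNIV\<close>
give all chains of submodules.
\<close>

definition has_chain ::
    "('a, 'r) ring_scheme \<Rightarrow> ('a, 'b, 'm) module_scheme \<Rightarrow> 'b set \<Rightarrow> 'b set \<Rightarrow> nat \<Rightarrow> bool"
  where "has_chain R M A B n \<longleftrightarrow>
    (\<exists>C. (\<forall>i\<le>n. submodule (C i) R M \<and> A \<subseteq> C i \<and> C i \<subseteq> B) \<and> (\<forall>i<n. C i \<subset> C (Suc i)))"

definition interval_length ::
    "('a, 'r) ring_scheme \<Rightarrow> ('a, 'b, 'm) module_scheme \<Rightarrow> 'b set \<Rightarrow> 'b set \<Rightarrow> enat"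
  where "interval_length R M A B = Sup {enat n | n. has_chain R M A B n}"

lemma enat_le_of_all:
  assumes "\<And>k. enat k \<le> a \<Longrightarrow> enat k \<le> b"
  shows "a \<le> b"
proof (cases a)
  case (enat n)
  then show ?thesis
    using assms[of n] by simp
next
  case infinity
  then have *: "enat n \<le> b" for n
    using assms by simp
  have "b = \<infinity>"
  proof (cases b)
    case (enat m)
    then show ?thesis
      using *[of "Suc m"] by simp
  qed
  then show ?thesis
    by simp
qed

lemma has_chain_mono:
  assumes "has_chain R M A B n" and "k \<le> n"
  shows "has_chain R M A B k"
  using assms unfolding has_chain_def by (meson le_trans less_le_trans)

lemma has_chain_0:
  assumes "submodule A R M" and "A \<subseteq> B"
  shows "has_chain R M A B 0"
  using assms unfolding has_chain_def by (intro exI[of _ "\<lambda>_. A"]) auto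

lemma has_chain_transfer:
  assumes "has_chain R M A B n"
    and "\<And>C. submodule C R M \<Longrightarrow> A \<subseteq> C \<Longrightarrow> C \<subseteq> B \<Longrightarrow>
      submodule (f C) R' M' \<and> A' \<subseteq> f C \<and> f C \<subseteq> B'"
    and "\<And>C D. submodule C R M \<Longrightarrow> submodule D R M \<Longrightarrow> A \<subseteq> C \<Longrightarrow> C \<subset> D \<Longrightarrow> D \<subseteq> B \<Longrightarrow> f C \<subset> f D"
  shows "has_chain R' M' A' B' n"
proof -
  obtain C where "\<forall>i\<le>n. submodule (C i) R M \<and> A \<subseteq> C i \<and> C i \<subseteq> B" "\<forall>i<n. C i \<subset> C (Suc i)"
    using assms(1) unfolding has_chain_def by blast
  then have "(\<forall>i\<le>n. submodule (f (C i)) R' M' \<and> A' \<subseteq> f (C i) \<and> f (C i) \<subseteq> B') \<and>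
      (\<forall>i<n. f (C i) \<subset> f (C (Suc i)))"
    using assms(2,3) by (simp add: Suc_leI)
  then show ?thesis
    unfolding has_chain_def by (rule exI[of _ "\<lambda>i. f (C i)"])
qed

lemma interval_length_le_iff:
  "interval_length R M A B \<le> b \<longleftrightarrow> (\<forall>n. has_chain R M A B n \<longrightarrow> enat n \<le> b)"
  unfolding interval_length_def by (auto simp: Sup_le_iff)

lemma le_interval_length:
  "has_chain R M A B n \<Longrightarrow> enat n \<le> interval_length R M A B"
  unfolding interval_length_def by (auto intro: Sup_upper)

text \<open>
The supremum of a nonempty set of natural numbers is attained or infinite, and chains can be cut short; so
a bound on the length can be traded for an actual chain.
\<close>

lemma has_chain_of_le_length:
  assumes "submodule A R M" and "A \<subseteq> B" and le: "enat n \<le> interval_length R M A B"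
  shows "has_chain R M A B n"
proof (cases n)
  case 0
  then show ?thesis
    using has_chain_0 assms by blast
next
  case (Suc k)
  then have "enat k < interval_length R M A B"
    using le by (meson enat_ord_simps(2) lessI order_less_le_trans)
  then obtain m where "has_chain R M A B m" "k < m"
    unfolding interval_length_def by (auto simp: less_Sup_iff)
  then show ?thesis
    using Suc has_chain_mono by (metis Suc_leI)
qed

text \<open>
Intervals are compared through strictly increasing maps, which may also go from the submodules of one module
to those of another.
\<close>

lemma interval_length_transfer:
  assumes "\<And>C. submodule C R M \<Longrightarrow> A \<subseteq> C \<Longrightarrow> C \<subseteq> B \<Longrightarrow>
      submodule (f C) R' M' \<and> A' \<subseteq> f C \<and> f C \<subseteq> B'"
    and "\<And>C D. submodule C R M \<Longrightarrow> submodule D R M \<Longrightarrow> A \<subseteq> C \<Longrightarrow> C \<subset> D \<Longrightarrow> D \<subseteq> B \<Longrightarrow> f C \<subset> f D"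
  shows "interval_length R M A B \<le> interval_length R' M' A' B'"
  unfolding interval_length_le_iff[of R M]
  using has_chain_transfer[where f = f, OF _ assms] le_interval_length by blast

lemma interval_length_mono:
  assumes "A' \<subseteq> A" and "B \<subseteq> B'"
  shows "interval_length R M A B \<le> interval_length R M A' B'"
  by (rule interval_length_transfer[where f = "\<lambda>C. C"]) (use assms in auto)

text \<open>
Deleting repetitions from a weakly increasing chain leaves as many steps as there were proper inclusions.
\<close>

lemma strict_chain_of_chain:
  assumes "\<And>i. i \<le> n \<Longrightarrow> submodule (D i) R M \<and> A \<subseteq> D i \<and> D i \<subseteq> B"
    and "\<And>i. i < n \<Longrightarrow> D i \<subseteq> D (Suc i)"
  shows "has_chain R M A B (card {i. i < n \<and> D i \<noteq> D (Suc i)})"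
proof -
  define s where "s n = card {i. i < n \<and> D i \<noteq> D (Suc i)}" for n
  have s_Suc: "s (Suc k) = (if D k = D (Suc k) then s k else Suc (s k))" for k
  proof -
    have "{i. i < Suc k \<and> D i \<noteq> D (Suc i)} =
        {i. i < k \<and> D i \<noteq> D (Suc i)} \<union> (if D k = D (Suc k) then {} else {k})"
      by (auto simp: less_Suc_eq)
    then show ?thesis
      by (simp add: s_def)
  qed
  have "\<exists>C. (\<forall>i\<le>s k. submodule (C i) R M \<and> A \<subseteq> C i \<and> C i \<subseteq> B) \<and>
      (\<forall>i<s k. C i \<subset> C (Suc i)) \<and> C (s k) = D k" if "k \<le> n" for k
    using that
  proof (induction k)
    case 0
    then show ?case
      using assms(1)[of 0] by (intro exI[of _ "\<lambda>_. D 0"]) (auto simp: s_def)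
  next
    case (Suc k)
    then obtain C where C: "\<forall>i\<le>s k. submodule (C i) R M \<and> A \<subseteq> C i \<and> C i \<subseteq> B"
        "\<forall>i<s k. C i \<subset> C (Suc i)" "C (s k) = D k"
      by auto
    show ?case
    proof (cases "D k = D (Suc k)")
      case True
      then show ?thesis
        using C by (intro exI[of _ C]) (auto simp: s_Suc)
    next
      case False
      then have "D k \<subset> D (Suc k)"
        using assms(2)[of k] Suc.prems by auto
      then show ?thesis
        using C False assms(1)[OF Suc.prems]
        by (intro exI[of _ "C(Suc (s k) := D (Suc k))"]) (auto simp: s_Suc le_Suc_eq less_Suc_eq)
    qed
  qed
  from this[of n] show ?thesis
    unfolding has_chain_def s_def[symmetric] by auto
qed

context module
begin

abbreviation len :: "'c set \<Rightarrow> 'c set \<Rightarrow> enat"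
  where "len A B \<equiv> interval_length R M A B"

lemma length_add_le:
  assumes A: "sub A" and B: "sub B" and AB: "A \<subseteq> B" and BC: "B \<subseteq> C"
  shows "len A B + len B C \<le> len A C"
proof -
  have *: "has_chain R M A C (m + n)" if ch: "has_chain R M A B m" "has_chain R M B C n" for m n
  proof -
    obtain D where D: "\<forall>i\<le>m. sub (D i) \<and> A \<subseteq> D i \<and> D i \<subseteq> B" "\<forall>i<m. D i \<subset> D (Suc i)"
      using ch(1) unfolding has_chain_def by blast
    obtain E where E: "\<forall>i\<le>n. sub (E i) \<and> B \<subseteq> E i \<and> E i \<subseteq> C" "\<forall>i<n. E i \<subset> E (Suc i)"
      using ch(2) unfolding has_chain_def by blast
    define F where "F i = (if i < m then D i else E (i - m))" for i
    have "sub (F i) \<and> A \<subseteq> F i \<and> F i \<subseteq> C" if "i \<le> m + n" for i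
    proof (cases "i < m")
      case True
      then have "sub (D i)" "A \<subseteq> D i" "D i \<subseteq> B"
        using D(1) by simp_all
      then show ?thesis
        using True BC by (simp add: F_def)
    next
      case False
      then have "sub (E (i - m))" "B \<subseteq> E (i - m)" "E (i - m) \<subseteq> C"
        using that E(1) by simp_all
      then show ?thesis
        using False AB by (simp add: F_def)
    qed
    moreover have "F i \<subset> F (Suc i)" if "i < m + n" for i
    proof (cases "i < m")
      case True
      have "D i \<subset> D (Suc i)" "D (Suc i) \<subseteq> B"
        using D True by auto
      moreover have "B \<subseteq> E 0"
        using E by blast
      ultimately show ?thesis
        using True by (auto simp: F_def not_less)
    next
      case False
      then have "Suc i - m = Suc (i - m)" "i - m < n"
        using that by auto
      then show ?thesis
        using False E(2) by (auto simp: F_def)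
    qed
    ultimately show ?thesis
      unfolding has_chain_def by blast
  qed
  have "enat k \<le> len A C" if k: "enat k \<le> len A B + len B C" for k
  proof -
    obtain i j where ij: "k = i + j" "enat i \<le> len A B" "enat j \<le> len B C"
    proof (cases "enat k \<le> len A B")
      case True
      then show ?thesis
        using that[of k 0] by (simp add: zero_enat_def[symmetric])
    next
      case False
      then obtain a where a: "len A B = enat a" "a \<le> k"
        by (cases "len A B") auto
      then have "enat (k - a) \<le> len B C"
        using k by (cases "len B C") auto
      then show ?thesis
        using that[of a "k - a"] a by simp
    qed
    then show ?thesis
      using le_interval_length[OF *] has_chain_of_le_length A B AB BC by blast
  qed
  then show ?thesis
    by (rule enat_le_of_all)
qed

text \<open>
A chain from \<open>A\<close> to \<open>C\<close> is intersected with \<open>B\<close> and summed with \<open>B\<close>. Each of its steps survives in at least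
one of the two resulting chains.
\<close>

lemma length_le_add:
  assumes B: "sub B"
  shows "len A C \<le> len (A \<inter> B) (C \<inter> B) + len (A +\<^sub>M B) (C +\<^sub>M B)"
  unfolding interval_length_le_iff[of R M A C]
proof (intro allI impI)
  fix n assume "has_chain R M A C n"
  then obtain D where D: "\<And>i. i \<le> n \<Longrightarrow> sub (D i) \<and> A \<subseteq> D i \<and> D i \<subseteq> C"
      "\<And>i. i < n \<Longrightarrow> D i \<subset> D (Suc i)"
    unfolding has_chain_def by blast
  let ?I = "{i. i < n \<and> D i \<inter> B \<noteq> D (Suc i) \<inter> B}"
  let ?J = "{i. i < n \<and> D i +\<^sub>M B \<noteq> D (Suc i) +\<^sub>M B}"
  have step: "D i \<subseteq> D (Suc i)" if "i < n" for i
    using D(2)[OF that] by blast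
  have c1: "has_chain R M (A \<inter> B) (C \<inter> B) (card ?I)"
  proof (rule strict_chain_of_chain[where D = "\<lambda>i. D i \<inter> B"])
    fix i assume "i \<le> n"
    then show "sub (D i \<inter> B) \<and> A \<inter> B \<subseteq> D i \<inter> B \<and> D i \<inter> B \<subseteq> C \<inter> B"
      using D(1)[of i] B inter_sub by blast
  qed (use step in blast)
  have c2: "has_chain R M (A +\<^sub>M B) (C +\<^sub>M B) (card ?J)"
  proof (rule strict_chain_of_chain[where D = "\<lambda>i. D i +\<^sub>M B"])
    fix i assume "i \<le> n"
    then show "sub (D i +\<^sub>M B) \<and> A +\<^sub>M B \<subseteq> D i +\<^sub>M B \<and> D i +\<^sub>M B \<subseteq> C +\<^sub>M B"
      using D(1)[of i] B sub_sum_closed sum_mono by blast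
  qed (use step sum_mono in blast)
  have "n \<le> card ?I + card ?J"
  proof -
    have "i \<in> ?I \<union> ?J" if "i < n" for i
      using eq_of_inter_sum_eq[of "D i" B "D (Suc i)"] D(1)[of i] D(1)[of "Suc i"] D(2)[of i] B that
      by auto
    then have "card {..<n} \<le> card (?I \<union> ?J)"
      by (intro card_mono) auto
    then show ?thesis
      using card_Un_le[of ?I ?J] by simp
  qed
  then have "enat n \<le> enat (card ?I) + enat (card ?J)"
    by simp
  also have "\<dots> \<le> len (A \<inter> B) (C \<inter> B) + len (A +\<^sub>M B) (C +\<^sub>M B)"
    by (intro add_mono le_interval_length c1 c2)
  finally show "enat n \<le> len (A \<inter> B) (C \<inter> B) + len (A +\<^sub>M B) (C +\<^sub>M B)" .
qed

corollary length_triangle: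
  assumes "sub A" "sub B" "sub C" "A \<subseteq> B" "B \<subseteq> C"
  shows "len A C \<le> len A B + len B C"
proof -
  have "A \<inter> B = A" "C \<inter> B = B"
    using assms by auto
  moreover have "A +\<^sub>M B = B"
    unfolding sum_commute[OF assms(1,2)] by (rule sum_absorb[OF assms(2,1,4)])
  moreover have "C +\<^sub>M B = C"
    by (rule sum_absorb[OF assms(3,2,5)])
  ultimately show ?thesis
    using length_le_add[OF assms(2), of A C] by (simp only:)
qed

text \<open>
The isomorphism \<open>A/(A \<inter> V) \<cong> (A + V)/V\<close>; the map \<open>C \<mapsto> C + V\<close> is injective because \<open>(C + V) \<inter> A = C\<close>.
\<close>

lemma length_second_iso:
  assumes A: "sub A" and V: "sub V"
  shows "len (A \<inter> V) A \<le> len V (A +\<^sub>M V)"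
proof (rule interval_length_transfer[where f = "\<lambda>C. C +\<^sub>M V"])
  fix C assume "sub C" "A \<inter> V \<subseteq> C" "C \<subseteq> A"
  then show "sub (C +\<^sub>M V) \<and> V \<subseteq> C +\<^sub>M V \<and> C +\<^sub>M V \<subseteq> A +\<^sub>M V"
    using sub_sum_closed[OF _ V, of C] sum_upper2[OF _ V, of C] sum_mono[of C A V V]
    by (simp only: order_refl)
next
  have rec: "(C +\<^sub>M V) \<inter> A = C" if "sub C" "A \<inter> V \<subseteq> C" "C \<subseteq> A" for C
    using modular_law[OF that(1) V A that(3)] sum_absorb[OF that(1) inter_sub[OF A V] that(2)]
    by (simp only: Int_commute[of V A])
  fix C D assume CD: "sub C" "sub D" "A \<inter> V \<subseteq> C" "C \<subset> D" "D \<subseteq> A"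
  have "(C +\<^sub>M V) \<inter> A = C"
    by (rule rec) (use CD in auto)
  moreover have "(D +\<^sub>M V) \<inter> A = D"
    by (rule rec) (use CD in auto)
  ultimately have "C +\<^sub>M V \<noteq> D +\<^sub>M V"
    using CD(4) by auto
  then show "C +\<^sub>M V \<subset> D +\<^sub>M V"
    using sum_mono[of C D V V] CD(4) by blast
qed

lemma preimage_sub:
  assumes x: "x \<in> carrier R" and B: "sub B" and C: "sub C"
  shows "sub {m \<in> B. x \<odot>\<^bsub>M\<^esub> m \<in> C}"
  by (rule submoduleI)
    (use x subD[OF B] subD[OF C] in \<open>auto simp: smult_r_distr smult_r_minus smult_left_commute[OF x]\<close>)

text \<open>
Multiplication by \<open>x\<close> maps \<open>B/A\<close> onto \<open>(xB + U)/(xA + U)\<close>. The submodule \<open>U\<close> stands for the elements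
that have already been divided out.
\<close>

lemma length_multiple_le:
  assumes x: "x \<in> carrier R" and A: "sub A" and B: "sub B" and U: "sub U" and AB: "A \<subseteq> B"
  shows "len (x \<cdot> A +\<^sub>M U) (x \<cdot> B +\<^sub>M U) \<le> len A B"
proof (rule interval_length_transfer[where f = "\<lambda>C. {m \<in> B. x \<odot>\<^bsub>M\<^esub> m \<in> C}"])
  fix C assume "sub C" "x \<cdot> A +\<^sub>M U \<subseteq> C"
  moreover have "x \<cdot> A \<subseteq> x \<cdot> A +\<^sub>M U"
    by (intro sum_upper1 multiple_sub x A U)
  ultimately show "sub {m \<in> B. x \<odot>\<^bsub>M\<^esub> m \<in> C} \<and> A \<subseteq> {m \<in> B. x \<odot>\<^bsub>M\<^esub> m \<in> C} \<and> {m \<in> B. x \<odot>\<^bsub>M\<^esub> m \<in> C} \<subseteq> B"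
    using preimage_sub[OF x B] AB by auto
next
  fix C D assume C: "sub C" and D: "sub D" and AC: "x \<cdot> A +\<^sub>M U \<subseteq> C"
    and CD: "C \<subset> D" and DB: "D \<subseteq> x \<cdot> B +\<^sub>M U"
  then obtain d where d: "d \<in> D" "d \<notin> C"
    by blast
  then obtain y u where yu: "y \<in> x \<cdot> B" "u \<in> U" "d = y \<oplus>\<^bsub>M\<^esub> u"
    using DB by (blast elim: mem_sumE)
  have u: "u \<in> C"
    using AC sum_upper2[OF multiple_sub[OF x A] U] yu by blast
  obtain b where b: "b \<in> B" "y = x \<odot>\<^bsub>M\<^esub> b"
    using yu(1) by blast
  have y: "y \<in> carrier M"
    using b x subD(2)[OF B] by simp
  have "u \<oplus>\<^bsub>M\<^esub> y \<in> D"
    using d yu y subD(2)[OF U] by (simp add: M.a_comm)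
  then have "y \<in> D"
    using add_mem_cancel[OF D _ y] u CD by blast
  moreover have "y \<notin> C"
    using d yu u subD(5)[OF C] by blast
  ultimately show "{m \<in> B. x \<odot>\<^bsub>M\<^esub> m \<in> C} \<subset> {m \<in> B. x \<odot>\<^bsub>M\<^esub> m \<in> D}"
    using b CD by blast
qed

end


section \<open>The maximal condition\<close>

lemma ex_maximal_of_acc:
  fixes F :: "'x set set"
  assumes "F \<noteq> {}"
    and acc: "\<And>f. (\<And>n::nat. f n \<in> F) \<Longrightarrow> (\<And>n. f n \<subseteq> f (Suc n)) \<Longrightarrow> \<exists>n. f (Suc n) = f n"
  shows "\<exists>K\<in>F. \<forall>L\<in>F. K \<subseteq> L \<longrightarrow> L = K"
proof (rule ccontr)
  assume contr: "\<not> ?thesis"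
  have "\<exists>f. \<forall>n. f n \<in> F \<and> f n \<subset> f (Suc n)"
  proof (rule dependent_nat_choice)
    show "\<exists>x. x \<in> F"
      using assms(1) by blast
    show "\<exists>y. y \<in> F \<and> x \<subset> y" if "x \<in> F" for x n
      using contr that by blast
  qed
  then show False
    using acc by (metis psubset_imp_subset less_irrefl)
qed

lemma (in noetherian_ring) ideal_chain_stabilises:
  assumes ideals: "\<And>n::nat. ideal (I n) R" and mono: "\<And>n. I n \<subseteq> I (Suc n)"
  shows "\<exists>n. \<forall>m\<ge>n. I m = I n"
proof -
  have mono': "I m \<subseteq> I n" if "m \<le> n" for m n
    using lift_Suc_mono_le[of I, OF mono that] .
  have "subset.chain {J. ideal J R} (range I)"
    unfolding subset_chain_def
  proof (intro conjI ballI)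
    show "range I \<subseteq> {J. ideal J R}"
      using ideals by auto
    fix J K assume "J \<in> range I" "K \<in> range I"
    then obtain i j where "J = I i" "K = I j"
      by blast
    then show "J \<subseteq> K \<or> K \<subseteq> J"
      using mono'[of i j] mono'[of j i] linear[of i j] by blast
  qed
  then have "\<Union> (range I) \<in> range I"
    by (intro ideal_chain_is_trivial) auto
  then obtain n where n: "\<Union> (range I) = I n"
    by (rule imageE)
  have "I m = I n" if "n \<le> m" for m
    using mono'[OF that] n by blast
  then show ?thesis
    by blast
qed

lemma (in noetherian_ring) ex_maximal_ideal_in:
  assumes "F \<noteq> {}" and "\<And>I. I \<in> F \<Longrightarrow> ideal I R"
  shows "\<exists>I\<in>F. \<forall>J\<in>F. I \<subseteq> J \<longrightarrow> J = I"
proof (rule ex_maximal_of_acc[OF assms(1)])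
  fix f :: "nat \<Rightarrow> 'a set"
  assume "\<And>n. f n \<in> F" "\<And>n. f n \<subseteq> f (Suc n)"
  then obtain n where "\<forall>m\<ge>n. f m = f n"
    using ideal_chain_stabilises[of f] assms(2) by blast
  then have "f (Suc n) = f n"
    by (meson le_SucI order_refl)
  then show "\<exists>n. f (Suc n) = f n" ..
qed

context module
begin

definition colon :: "'c set \<Rightarrow> 'c \<Rightarrow> 'a set"
  where "colon K m = {r \<in> carrier R. r \<odot>\<^bsub>M\<^esub> m \<in> K}"

lemma colon_ideal:
  assumes K: "sub K" and m: "m \<in> carrier M"
  shows "ideal (colon K m) R"
proof (rule idealI)
  show "ring R"
    using R.ring_axioms .
  show "subgroup (colon K m) (add_monoid R)"
  proof (rule R.add.subgroupI)
    show "colon K m \<subseteq> carrier R"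
      by (auto simp: colon_def)
    have "\<zero>\<^bsub>R\<^esub> \<in> colon K m"
      using subD(3)[OF K] m by (simp add: colon_def)
    then show "colon K m \<noteq> {}"
      by blast
    fix a assume a: "a \<in> colon K m"
    then show "\<ominus>\<^bsub>R\<^esub> a \<in> colon K m"
      using subD(4)[OF K] m by (simp add: colon_def smult_l_minus)
    fix b assume "b \<in> colon K m"
    then show "a \<oplus>\<^bsub>R\<^esub> b \<in> colon K m"
      using a subD(5)[OF K] m by (simp add: colon_def smult_l_distr)
  qed
  fix a x assume "a \<in> colon K m" "x \<in> carrier R"
  then show "x \<otimes>\<^bsub>R\<^esub> a \<in> colon K m"
    using subD(6)[OF K] m by (simp add: colon_def smult_assoc1)
  then show "a \<otimes>\<^bsub>R\<^esub> x \<in> colon K m"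
    using \<open>a \<in> colon K m\<close> \<open>x \<in> carrier R\<close> by (simp add: colon_def R.m_comm)
qed

lemma colon_mono: "K \<subseteq> L \<Longrightarrow> colon K m \<subseteq> colon L m"
  by (auto simp: colon_def)

lemma zero_sub: "sub {\<zero>\<^bsub>M\<^esub>}"
  by (rule submoduleI) auto

lemma ideal_multiples_sub:
  assumes I: "ideal I R" and m: "m \<in> carrier M"
  shows "sub ((\<lambda>r. r \<odot>\<^bsub>M\<^esub> m) ` I)"
proof (rule submoduleI)
  interpret I: ideal I R
    by (rule I)
  show "(\<lambda>r. r \<odot>\<^bsub>M\<^esub> m) ` I \<subseteq> carrier M"
    using m I.Icarr by auto
  show "\<zero>\<^bsub>M\<^esub> \<in> (\<lambda>r. r \<odot>\<^bsub>M\<^esub> m) ` I"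
    by (rule image_eqI[of _ _ "\<zero>\<^bsub>R\<^esub>"]) (use m I.zero_closed in auto)
  show "\<ominus>\<^bsub>M\<^esub> a \<in> (\<lambda>r. r \<odot>\<^bsub>M\<^esub> m) ` I" if "a \<in> (\<lambda>r. r \<odot>\<^bsub>M\<^esub> m) ` I" for a
  proof -
    from that obtain r where r: "r \<in> I" "a = r \<odot>\<^bsub>M\<^esub> m"
      by blast
    show ?thesis
      by (rule image_eqI[of _ _ "\<ominus>\<^bsub>R\<^esub> r"]) (use r m I.Icarr in \<open>auto simp: smult_l_minus\<close>)
  qed
  show "a \<oplus>\<^bsub>M\<^esub> b \<in> (\<lambda>r. r \<odot>\<^bsub>M\<^esub> m) ` I"
    if ab: "a \<in> (\<lambda>r. r \<odot>\<^bsub>M\<^esub> m) ` I" "b \<in> (\<lambda>r. r \<odot>\<^bsub>M\<^esub> m) ` I" for a b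
  proof -
    from ab obtain r t where r: "r \<in> I" "a = r \<odot>\<^bsub>M\<^esub> m" "t \<in> I" "b = t \<odot>\<^bsub>M\<^esub> m"
      by blast
    show ?thesis
      by (rule image_eqI[of _ _ "r \<oplus>\<^bsub>R\<^esub> t"]) (use r m I.Icarr in \<open>auto simp: smult_l_distr\<close>)
  qed
  show "x \<odot>\<^bsub>M\<^esub> a \<in> (\<lambda>r. r \<odot>\<^bsub>M\<^esub> m) ` I"
    if xa: "x \<in> carrier R" "a \<in> (\<lambda>r. r \<odot>\<^bsub>M\<^esub> m) ` I" for x a
  proof -
    from xa obtain r where r: "r \<in> I" "a = r \<odot>\<^bsub>M\<^esub> m"
      by blast
    show ?thesis
      by (rule image_eqI[of _ _ "x \<otimes>\<^bsub>R\<^esub> r"])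
        (use r m xa(1) I.Icarr I.I_l_closed in \<open>auto simp: smult_assoc1\<close>)
  qed
qed

definition cyclic :: "'c \<Rightarrow> 'c set"
  where "cyclic m = (\<lambda>r. r \<odot>\<^bsub>M\<^esub> m) ` carrier R"

lemma cyclic_sub: "m \<in> carrier M \<Longrightarrow> sub (cyclic m)"
  unfolding cyclic_def by (rule ideal_multiples_sub[OF R.oneideal])

lemma self_mem_cyclic: "m \<in> carrier M \<Longrightarrow> m \<in> cyclic m"
  unfolding cyclic_def by (rule image_eqI[of _ _ "\<one>\<^bsub>R\<^esub>"]) auto

definition maximal_condition :: bool
  where "maximal_condition \<longleftrightarrow>
    (\<forall>F. F \<noteq> {} \<and> (\<forall>K\<in>F. sub K) \<longrightarrow> (\<exists>K\<in>F. \<forall>L\<in>F. K \<subseteq> L \<longrightarrow> L = K))"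

lemma maximal_conditionD:
  assumes "maximal_condition" "F \<noteq> {}" "\<And>K. K \<in> F \<Longrightarrow> sub K"
  shows "\<exists>K\<in>F. \<forall>L\<in>F. K \<subseteq> L \<longrightarrow> L = K"
  using assms unfolding maximal_condition_def by auto

text \<open>
Adding one generator \<open>m\<close> preserves the ascending chain condition: the part of \<open>C n\<close> outside \<open>B\<close> is
controlled by the ideal of all \<open>r\<close> with \<open>rm \<in> C n + B\<close>, and ideals of \<open>R\<close> stabilise.
\<close>

lemma chain_stabilises_on_insert:
  assumes "noetherian_ring R"
    and B: "sub B" and m: "m \<in> carrier M"
    and stab: "\<exists>n. \<forall>i\<ge>n. C i \<inter> B \<subseteq> C n"
    and C: "\<And>n::nat. sub (C n)" and mono: "\<And>n. C n \<subseteq> C (Suc n)"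
  shows "\<exists>n. \<forall>i\<ge>n. C i \<inter> (B +\<^sub>M cyclic m) \<subseteq> C n"
proof -
  interpret noetherian_ring R
    by fact
  have mono': "C i \<subseteq> C j" if "i \<le> j" for i j
    using lift_Suc_mono_le[of C, OF mono that] .
  obtain k where k: "\<And>i. i \<ge> k \<Longrightarrow> C i \<inter> B \<subseteq> C k"
    using stab by blast
  have "\<exists>n. \<forall>i\<ge>n. colon (C i +\<^sub>M B) m = colon (C n +\<^sub>M B) m"
    by (intro ideal_chain_stabilises colon_ideal sub_sum_closed colon_mono sum_mono C B m mono order_refl)
  then obtain l where l: "\<And>i. i \<ge> l \<Longrightarrow> colon (C i +\<^sub>M B) m = colon (C l +\<^sub>M B) m"
    by blast
  have "C i \<inter> (B +\<^sub>M cyclic m) \<subseteq> C (max k l)" if i: "i \<ge> max k l" for i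
  proof
    fix c assume c: "c \<in> C i \<inter> (B +\<^sub>M cyclic m)"
    then obtain b y where "b \<in> B" "y \<in> cyclic m" "c = b \<oplus>\<^bsub>M\<^esub> y"
      by (blast elim: mem_sumE)
    then obtain r where br: "b \<in> B" "r \<in> carrier R" "c = b \<oplus>\<^bsub>M\<^esub> r \<odot>\<^bsub>M\<^esub> m"
      by (auto simp: cyclic_def)
    note cl = subD(2)[OF B] subD(2)[OF C] m
    have "r \<odot>\<^bsub>M\<^esub> m \<in> C i +\<^sub>M B"
    proof (rule add_mem_cancel[OF sub_sum_closed[OF C B]])
      show "b \<in> C i +\<^sub>M B"
        using sum_upper2[OF C B] br by blast
      show "b \<oplus>\<^bsub>M\<^esub> r \<odot>\<^bsub>M\<^esub> m \<in> C i +\<^sub>M B"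
        using sum_upper1[OF C B] br c by blast
    qed (use br m in simp)
    then have "r \<in> colon (C l +\<^sub>M B) m"
      using l[of i] i br by (auto simp: colon_def)
    then obtain c' b' where c'b': "c' \<in> C l" "b' \<in> B" "r \<odot>\<^bsub>M\<^esub> m = c' \<oplus>\<^bsub>M\<^esub> b'"
      by (auto simp: colon_def elim: mem_sumE)
    have eq: "c = c' \<oplus>\<^bsub>M\<^esub> (b \<oplus>\<^bsub>M\<^esub> b')"
      using br(1,3) c'b' cl by (simp add: M.a_ac)
    have "b \<oplus>\<^bsub>M\<^esub> b' \<in> C i"
    proof (rule add_mem_cancel[OF C])
      show "c' \<in> C i"
        using c'b' mono'[of l i] i by auto
      show "c' \<oplus>\<^bsub>M\<^esub> (b \<oplus>\<^bsub>M\<^esub> b') \<in> C i"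
        using eq c by simp
    qed (use br c'b' cl in auto)
    then have "b \<oplus>\<^bsub>M\<^esub> b' \<in> C k"
      using k[of i] i subD(5)[OF B br(1) c'b'(2)] by auto
    then have "b \<oplus>\<^bsub>M\<^esub> b' \<in> C (max k l)"
      using mono'[of k "max k l"] by auto
    moreover have "c' \<in> C (max k l)"
      using mono'[of l "max k l"] c'b' by auto
    ultimately show "c \<in> C (max k l)"
      unfolding eq by (rule subD(5)[OF C, rotated])
  qed
  then show ?thesis
    by blast
qed

lemma finitely_generated_maximal_condition:
  assumes R: "noetherian_ring R" and "finitely_generated_module R M"
  shows maximal_condition
proof -
  obtain S where S: "S \<subseteq> carrier M" "finite S" "submodule_span R M S = carrier M"
    using assms(2) unfolding finitely_generated_module_def by blast
  have "\<exists>B. sub B \<and> T \<subseteq> B \<and> (\<forall>C::nat \<Rightarrow> 'c set. (\<forall>n. sub (C n) \<and> C n \<subseteq> C (Suc n)) \<longrightarrow>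
      (\<exists>n. \<forall>i\<ge>n. C i \<inter> B \<subseteq> C n))" if "finite T" "T \<subseteq> carrier M" for T
    using that
  proof (induction T rule: finite_induct)
    case empty
    have "C i \<inter> {\<zero>\<^bsub>M\<^esub>} \<subseteq> C 0" if "\<forall>n. sub (C n)" for C :: "nat \<Rightarrow> 'c set" and i
      using that subD(3) by blast
    then show ?case
      using zero_sub by (intro exI[of _ "{\<zero>\<^bsub>M\<^esub>}"]) blast
  next
    case (insert m T)
    then obtain B where B: "sub B" "T \<subseteq> B"
        "\<And>C::nat \<Rightarrow> 'c set. (\<forall>n. sub (C n) \<and> C n \<subseteq> C (Suc n)) \<Longrightarrow> (\<exists>n. \<forall>i\<ge>n. C i \<inter> B \<subseteq> C n)"
      by blast
    have m: "m \<in> carrier M"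
      using insert.prems by simp
    show ?case
    proof (intro exI[of _ "B +\<^sub>M cyclic m"] conjI allI impI)
      show "sub (B +\<^sub>M cyclic m)"
        by (intro sub_sum_closed B cyclic_sub m)
      show "insert m T \<subseteq> B +\<^sub>M cyclic m"
        using B(2) sum_upper1[OF B(1) cyclic_sub[OF m]] sum_upper2[OF B(1) cyclic_sub[OF m]]
          self_mem_cyclic[OF m] by blast
      fix C :: "nat \<Rightarrow> 'c set" assume C: "\<forall>n. sub (C n) \<and> C n \<subseteq> C (Suc n)"
      show "\<exists>n. \<forall>i\<ge>n. C i \<inter> (B +\<^sub>M cyclic m) \<subseteq> C n"
        by (rule chain_stabilises_on_insert[OF R B(1) m B(3)]) (use C in auto)
    qed
  qed
  from this[OF S(2,1)] obtain B where B: "sub B" "S \<subseteq> B"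
      "\<And>C::nat \<Rightarrow> 'c set. (\<forall>n. sub (C n) \<and> C n \<subseteq> C (Suc n)) \<Longrightarrow> (\<exists>n. \<forall>i\<ge>n. C i \<inter> B \<subseteq> C n)"
    by blast
  have BM: "carrier M \<subseteq> B"
    using B(1,2) S(3) unfolding submodule_span_def by blast
  show ?thesis
    unfolding maximal_condition_def
  proof (intro allI impI, elim conjE)
    fix F :: "'c set set" assume F: "F \<noteq> {}" "\<forall>K\<in>F. sub K"
    show "\<exists>K\<in>F. \<forall>L\<in>F. K \<subseteq> L \<longrightarrow> L = K"
    proof (rule ex_maximal_of_acc[OF F(1)])
      fix f :: "nat \<Rightarrow> 'c set"
      assume f: "\<And>n. f n \<in> F" "\<And>n. f n \<subseteq> f (Suc n)"
      then have sub: "sub (f n)" for n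
        using F by blast
      then obtain n where n: "\<forall>i\<ge>n. f i \<inter> B \<subseteq> f n"
        using B(3)[of f] f by blast
      have "f (Suc n) \<subseteq> f n"
        using n[rule_format, of "Suc n"] subD(1)[OF sub] BM by (metis Int_absorb2 le_SucI order_refl order_trans)
      then show "\<exists>n. f (Suc n) = f n"
        using f(2) by blast
    qed
  qed
qed

section \<open>One parameter\<close>

text \<open>
The colon submodule \<open>N :\<^bsub>M\<^esub> x\<close>.
\<close>

definition divided :: "'a \<Rightarrow> 'c set \<Rightarrow> 'c set"
  where "divided x N = {m \<in> carrier M. x \<odot>\<^bsub>M\<^esub> m \<in> N}"

lemma divided_sub: "x \<in> carrier R \<Longrightarrow> sub N \<Longrightarrow> sub (divided x N)"
  unfolding divided_def by (rule preimage_sub[OF _ carrier_is_submodule])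

lemma subset_divided: "x \<in> carrier R \<Longrightarrow> sub N \<Longrightarrow> N \<subseteq> divided x N"
  unfolding divided_def by (auto dest: subD(2) intro: subD(6))

text \<open>
With \<open>X = N : x\<close> one has \<open>xX \<subseteq> N \<subseteq> X\<close>, and \<open>X/(xN + U)\<close> is filtered both through \<open>N\<close> and through
\<open>xX + U\<close>. The factors \<open>X/N\<close> and \<open>(xX + U)/(xN + U)\<close> are compared by multiplication with \<open>x\<close> and can be
cancelled, as \<open>X/N\<close> is a quotient of \<open>X/(xX + U)\<close> and so has finite length in the case of interest.
\<close>

lemma length_mod_multiple_le_divided:
  assumes x: "x \<in> carrier R" and U: "sub U" and N: "sub N" and UN: "U \<subseteq> N"
  shows "len (x \<cdot> N +\<^sub>M U) N \<le> len (x \<cdot> divided x N +\<^sub>M U) (divided x N)"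
proof (cases "len (x \<cdot> divided x N +\<^sub>M U) (divided x N)")
  case (enat c)
  let ?X = "divided x N"
  have X: "sub ?X" and NX: "N \<subseteq> ?X"
    using divided_sub[OF x N] subset_divided[OF x N] .
  have xN: "sub (x \<cdot> N +\<^sub>M U)" and xX: "sub (x \<cdot> ?X +\<^sub>M U)"
    by (intro sub_sum_closed multiple_sub x U N X)+
  have xNN: "x \<cdot> N +\<^sub>M U \<subseteq> N" and xXN: "x \<cdot> ?X +\<^sub>M U \<subseteq> N"
    by (intro sum_least N UN multiple_subset x) (intro sum_least N UN, auto simp: divided_def)
  have *: "len N ?X \<le> enat c"
    using interval_length_mono[OF xXN order_refl] enat by metis
  have "len (x \<cdot> N +\<^sub>M U) N + len N ?X \<le> len (x \<cdot> N +\<^sub>M U) ?X"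
    by (rule length_add_le[OF xN N xNN NX])
  also have "\<dots> \<le> len (x \<cdot> N +\<^sub>M U) (x \<cdot> ?X +\<^sub>M U) + len (x \<cdot> ?X +\<^sub>M U) ?X"
    using NX xXN by (intro length_triangle xN xX X sum_mono image_mono) auto
  also have "\<dots> \<le> len N ?X + len (x \<cdot> ?X +\<^sub>M U) ?X"
    by (intro add_right_mono length_multiple_le x N X U NX)
  finally show ?thesis
    using * unfolding enat by (cases "len N ?X"; cases "len (x \<cdot> N +\<^sub>M U) N") auto
qed simp

text \<open>
The submodules \<open>N : x\<^sup>i\<close> become constant. The length in question does not decrease along them, and for the
last one, on whose quotient \<open>x\<close> is regular, \<open>X \<inter> (xM + U) = xX + U\<close>.
\<close>

proposition length_mod_one_parameter:
  assumes mc: maximal_condition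
    and x: "x \<in> carrier R" and U: "sub U" and N: "sub N" and UN: "U \<subseteq> N"
  shows "len (x \<cdot> N +\<^sub>M U) N \<le> len (x \<cdot> carrier M +\<^sub>M U) (carrier M)"
proof -
  define D where "D i = (divided x ^^ i) N" for i :: nat
  have D: "sub (D i) \<and> U \<subseteq> D i" for i
  proof (induction i)
    case (Suc i)
    have "D (Suc i) = divided x (D i)"
      by (simp add: D_def)
    then show ?case
      using subset_divided[OF x, of "D i"] divided_sub[OF x, of "D i"] Suc by auto
  qed (simp add: D_def N UN)
  have D_Suc: "D (Suc i) = divided x (D i)" for i
    by (simp add: D_def)
  have "\<exists>K\<in>range D. \<forall>L\<in>range D. K \<subseteq> L \<longrightarrow> L = K"
    by (rule maximal_conditionD[OF mc]) (use D in auto)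
  then obtain n where "\<forall>L\<in>range D. D n \<subseteq> L \<longrightarrow> L = D n"
    by blast
  then have stable: "divided x (D n) = D n"
    using subset_divided[OF x, of "D n"] D by (metis D_Suc rangeI)
  have "len (x \<cdot> N +\<^sub>M U) N \<le> len (x \<cdot> D i +\<^sub>M U) (D i)" for i
  proof (induction i)
    case 0
    then show ?case
      by (simp add: D_def)
  next
    case (Suc i)
    then show ?case
      unfolding D_Suc using length_mod_multiple_le_divided[OF x U, of "D i"] D by (meson order_trans)
  qed
  also have "len (x \<cdot> D n +\<^sub>M U) (D n) \<le> len (x \<cdot> carrier M +\<^sub>M U) (carrier M)"
  proof -
    let ?V = "x \<cdot> carrier M +\<^sub>M U"
    have V: "sub ?V"
      by (intro sub_sum_closed multiple_sub x carrier_is_submodule U)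
    have Dn: "sub (D n)" "U \<subseteq> D n"
      using D by auto
    have "D n \<inter> ?V \<subseteq> x \<cdot> D n +\<^sub>M U"
    proof
      fix d assume d: "d \<in> D n \<inter> ?V"
      then obtain m u where mu: "m \<in> carrier M" "u \<in> U" "d = x \<odot>\<^bsub>M\<^esub> m \<oplus>\<^bsub>M\<^esub> u"
        by (auto elim: mem_sumE)
      have "u \<oplus>\<^bsub>M\<^esub> x \<odot>\<^bsub>M\<^esub> m \<in> D n"
        using mu d x subD(2)[OF U] by (simp add: M.a_comm)
      then have "x \<odot>\<^bsub>M\<^esub> m \<in> D n"
        using add_mem_cancel[OF Dn(1)] mu Dn(2) x by blast
      then have "m \<in> D n"
        using stable mu by (auto simp: divided_def)
      then show "d \<in> x \<cdot> D n +\<^sub>M U"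
        using mu by (auto intro: sum_memI)
    qed
    then have "len (x \<cdot> D n +\<^sub>M U) (D n) \<le> len (D n \<inter> ?V) (D n)"
      by (rule interval_length_mono) simp
    also have "\<dots> \<le> len ?V (D n +\<^sub>M ?V)"
      by (rule length_second_iso[OF Dn(1) V])
    also have "\<dots> \<le> len ?V (carrier M)"
      using subD(1)[OF sub_sum_closed[OF Dn(1) V]] by (intro interval_length_mono) auto
    finally show ?thesis .
  qed
  finally show ?thesis .
qed

end


section \<open>Avoiding finitely many primes\<close>

lemma (in cring) ex_mem_inter_not_mem_prime:
  assumes P: "primeideal P R" and "finite \<Q>"
    and "\<And>Q. Q \<in> \<Q> \<Longrightarrow> ideal Q R \<and> \<not> Q \<subseteq> P"
  shows "\<exists>e\<in>carrier R. e \<notin> P \<and> (\<forall>Q\<in>\<Q>. e \<in> Q)"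
  using assms(2,3)
proof (induction \<Q> rule: finite_induct)
  case empty
  have "\<one> \<notin> P"
    using ideal.one_imp_carrier[OF primeideal.axioms(1)[OF P]] primeideal.I_notcarr[OF P] by blast
  then show ?case
    by auto
next
  case (insert Q \<Q>)
  then obtain e where e: "e \<in> carrier R" "e \<notin> P" "\<forall>Q\<in>\<Q>. e \<in> Q"
    by auto
  obtain q where q: "q \<in> Q" "q \<notin> P"
    using insert.prems by blast
  have Q: "ideal Q' R" if "Q' \<in> insert Q \<Q>" for Q'
    using insert.prems that by blast
  have qR: "q \<in> carrier R"
    using ideal.Icarr[OF Q] q by blast
  have "e \<otimes> q \<notin> P"
    using primeideal.I_prime[OF P e(1) qR] e(2) q(2) by blast
  moreover have "e \<otimes> q \<in> Q'" if "Q' \<in> insert Q \<Q>" for Q'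
    using that e q qR ideal.I_l_closed[OF Q[OF that]] ideal.I_r_closed[OF Q[OF that]] by auto
  ultimately show ?case
    using e(1) qR by blast
qed

lemma (in cring) ideal_minus_closed:
  assumes "ideal I R" "a \<in> I" "b \<in> I"
  shows "a \<ominus> b \<in> I"
  using assms unfolding a_minus_def
  by (meson additive_subgroup.a_closed additive_subgroup.a_inv_closed ideal.axioms(1))

text \<open>
Prime avoidance in a coset. By induction on the number of primes, where the prime \<open>Q\<close> treated last is minimal among
them: if \<open>x + c\<close> avoids the others but lies in \<open>Q\<close>, then \<open>J\<close> is not contained in \<open>Q\<close>, and one adds a product
\<open>ej\<close> with \<open>j \<in> J\<close> and \<open>e\<close> in all the other primes, both outside \<open>Q\<close>. Minimality of \<open>Q\<close> provides \<open>e\<close>.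
\<close>

lemma (in cring) ex_add_avoiding_primes:
  assumes x: "x \<in> carrier R" and J: "ideal J R" and "finite \<Q>"
    and "\<And>Q. Q \<in> \<Q> \<Longrightarrow> primeideal Q R \<and> (x \<notin> Q \<or> \<not> J \<subseteq> Q)"
  shows "\<exists>c\<in>J. \<forall>Q\<in>\<Q>. x \<oplus> c \<notin> Q"
  using assms(3,4)
proof (induction \<Q> rule: finite_psubset_induct)
  case (psubset \<Q>)
  show ?case
  proof (cases "\<Q> = {}")
    case True
    have "\<zero> \<in> J"
      using J by (simp add: ideal.axioms(1) additive_subgroup.zero_closed)
    then show ?thesis
      using True by auto
  next
    case False
    then obtain Q where Q: "Q \<in> \<Q>" and min: "\<And>Q'. Q' \<in> \<Q> \<Longrightarrow> Q' \<subseteq> Q \<Longrightarrow> Q' = Q"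
      using finite_has_minimal[OF psubset.hyps(1)] by blast
    have "\<Q> - {Q} \<subset> \<Q>"
      using Q by blast
    then obtain c where c: "c \<in> J" "\<forall>Q'\<in>\<Q> - {Q}. x \<oplus> c \<notin> Q'"
      using psubset.IH[of "\<Q> - {Q}"] psubset.prems by auto
    have cR: "c \<in> carrier R"
      using ideal.Icarr[OF J c(1)] .
    have QP: "primeideal Q R" and QI: "ideal Q R"
      using psubset.prems[OF Q] primeideal.axioms(1) by auto
    show ?thesis
    proof (cases "x \<oplus> c \<in> Q")
      case False
      then show ?thesis
        using c by blast
    next
      case True
      have "\<not> J \<subseteq> Q"
      proof
        assume JQ: "J \<subseteq> Q"
        have "(x \<oplus> c) \<ominus> c \<in> Q"
          using ideal_minus_closed[OF QI True] c(1) JQ by blast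
        moreover have "(x \<oplus> c) \<ominus> c = x"
          using x cR by algebra
        ultimately show False
          using psubset.prems[OF Q] JQ by simp
      qed
      then obtain j where j: "j \<in> J" "j \<notin> Q"
        by blast
      have jR: "j \<in> carrier R"
        using ideal.Icarr[OF J j(1)] .
      obtain e where e: "e \<in> carrier R" "e \<notin> Q" "\<forall>Q'\<in>\<Q> - {Q}. e \<in> Q'"
        using ex_mem_inter_not_mem_prime[OF QP, of "\<Q> - {Q}"] psubset.hyps psubset.prems min primeideal.axioms(1)
        by (metis DiffE finite_Diff insertI1)
      have ejJ: "e \<otimes> j \<in> J"
        using ideal.I_l_closed[OF J j(1) e(1)] .
      have diff: "(x \<oplus> (c \<oplus> e \<otimes> j)) \<ominus> (x \<oplus> c) = e \<otimes> j" "(x \<oplus> (c \<oplus> e \<otimes> j)) \<ominus> e \<otimes> j = x \<oplus> c"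
        using x cR e jR by algebra+
      have "x \<oplus> (c \<oplus> e \<otimes> j) \<notin> Q"
      proof
        assume "x \<oplus> (c \<oplus> e \<otimes> j) \<in> Q"
        then have "e \<otimes> j \<in> Q"
          using ideal_minus_closed[OF QI _ True] diff(1) by metis
        then show False
          using primeideal.I_prime[OF QP e(1) jR] e j by blast
      qed
      moreover have "x \<oplus> (c \<oplus> e \<otimes> j) \<notin> Q'" if Q': "Q' \<in> \<Q> - {Q}" for Q'
      proof
        have Q'I: "ideal Q' R"
          using psubset.prems Q' primeideal.axioms(1) by blast
        assume "x \<oplus> (c \<oplus> e \<otimes> j) \<in> Q'"
        moreover have "e \<otimes> j \<in> Q'"
          using ideal.I_r_closed[OF Q'I] e Q' jR by blast
        ultimately have "x \<oplus> c \<in> Q'"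
          using ideal_minus_closed[OF Q'I] diff(2) by metis
        then show False
          using c Q' by blast
      qed
      moreover have "c \<oplus> e \<otimes> j \<in> J"
        using additive_subgroup.a_closed[OF ideal.axioms(1)[OF J] c(1) ejJ] .
      ultimately show ?thesis
        by blast
    qed
  qed
qed

context module
begin

text \<open>
The maximal elements among the annihilators of nonzero elements of \<open>M/K\<close>: the maximal associated primes.
\<close>

definition maximal_colons :: "'c set \<Rightarrow> 'a set set"
  where "maximal_colons K = {P. \<exists>l. l \<in> carrier M - K \<and> P = colon K l \<and>
    (\<forall>l'. l' \<in> carrier M - K \<longrightarrow> P \<subseteq> colon K l' \<longrightarrow> colon K l' = P)}"

lemma maximal_colonE:
  assumes "P \<in> maximal_colons K"
  obtains l where "l \<in> carrier M" "l \<notin> K" "P = colon K l"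
    "\<forall>l'. l' \<in> carrier M - K \<longrightarrow> P \<subseteq> colon K l' \<longrightarrow> colon K l' = P"
proof -
  have "\<exists>l. l \<in> carrier M - K \<and> P = colon K l \<and>
      (\<forall>l'. l' \<in> carrier M - K \<longrightarrow> P \<subseteq> colon K l' \<longrightarrow> colon K l' = P)"
    using assms unfolding maximal_colons_def by (rule CollectD)
  then obtain l where l: "l \<in> carrier M - K" "P = colon K l"
      "\<forall>l'. l' \<in> carrier M - K \<longrightarrow> P \<subseteq> colon K l' \<longrightarrow> colon K l' = P"
    by (elim exE conjE)
  show ?thesis
    using l(1) by (intro that[OF _ _ l(2,3)]) auto
qed

lemma maximal_colon_prime:
  assumes K: "sub K" and P: "P \<in> maximal_colons K"
  shows "primeideal P R"
proof -
  obtain l where l: "l \<in> carrier M" "l \<notin> K" "P = colon K l"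
    and max: "\<forall>l'. l' \<in> carrier M - K \<longrightarrow> P \<subseteq> colon K l' \<longrightarrow> colon K l' = P"
    by (rule maximal_colonE[OF P])
  show ?thesis
  proof (rule primeidealI)
    show ideal: "ideal P R"
      unfolding l(3) by (rule colon_ideal[OF K l(1)])
    show "cring R" ..
    have "\<one>\<^bsub>R\<^esub> \<notin> P"
      using l by (simp add: colon_def)
    then show "carrier R \<noteq> P"
      by auto
    fix a b assume ab: "a \<in> carrier R" "b \<in> carrier R" "a \<otimes>\<^bsub>R\<^esub> b \<in> P"
    show "a \<in> P \<or> b \<in> P"
    proof (cases "b \<in> P")
      case False
      then have bl: "b \<odot>\<^bsub>M\<^esub> l \<notin> K"
        using ab l by (simp add: colon_def)
      have "P \<subseteq> colon K (b \<odot>\<^bsub>M\<^esub> l)"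
        using l(1) ab subD(6)[OF K] unfolding l(3) by (auto simp: colon_def smult_left_commute[of _ b])
      then have "colon K (b \<odot>\<^bsub>M\<^esub> l) = P"
        using max ab l bl by simp
      moreover have "a \<in> colon K (b \<odot>\<^bsub>M\<^esub> l)"
        using ab l by (simp add: colon_def smult_assoc1)
      ultimately show ?thesis
        by simp
    qed simp
  qed
qed

lemma colon_subset_maximal:
  assumes R: "noetherian_ring R" and K: "sub K" and m: "m \<in> carrier M" "m \<notin> K"
  shows "\<exists>P\<in>maximal_colons K. colon K m \<subseteq> P"
proof -
  interpret noetherian_ring R
    by fact
  define F where "F = colon K ` {l \<in> carrier M - K. colon K m \<subseteq> colon K l}"
  have "\<exists>I\<in>F. \<forall>J\<in>F. I \<subseteq> J \<longrightarrow> J = I"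
  proof (rule ex_maximal_ideal_in)
    show "F \<noteq> {}"
      using m by (auto simp: F_def)
    show "ideal I R" if "I \<in> F" for I
      using that colon_ideal[OF K] by (auto simp: F_def)
  qed
  then obtain P where P: "P \<in> F" and max: "\<And>J. J \<in> F \<Longrightarrow> P \<subseteq> J \<Longrightarrow> J = P"
    by blast
  from P obtain l where l: "l \<in> carrier M - K" "P = colon K l" "colon K m \<subseteq> P"
    by (auto simp: F_def)
  have "colon K l' = P" if "l' \<in> carrier M - K" "P \<subseteq> colon K l'" for l'
    using max[of "colon K l'"] that l(3) by (simp add: F_def)
  then have "P \<in> maximal_colons K"
    using l(1,2) unfolding maximal_colons_def by blast
  then show ?thesis
    using l(3) by blast
qed

text \<open>
For a finite set \<open>F\<close> of these primes let \<open>S F\<close> consist of the elements that \<open>\<Inter>F\<close> sends into \<open>K\<close>. Choose \<open>F\<close>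
with \<open>S F\<close> maximal. Enlarging \<open>F\<close> by another such prime \<open>P = colon K l\<close> does not change \<open>S F\<close>, so
\<open>l \<in> S F\<close>, that is, \<open>\<Inter>F \<subseteq> P\<close>. As \<open>P\<close> is prime, it contains a member of \<open>F\<close>, hence equals it by maximality.
\<close>

lemma finite_maximal_colons:
  assumes mc: maximal_condition and K: "sub K"
  shows "finite (maximal_colons K)"
proof -
  define S where "S F = {m \<in> carrier M. \<forall>r\<in>carrier R. (\<forall>Q\<in>F. r \<in> Q) \<longrightarrow> r \<odot>\<^bsub>M\<^esub> m \<in> K}" for F
  have S: "sub (S F)" for F
  proof (rule submoduleI)
    show "S F \<subseteq> carrier M"
      by (auto simp: S_def)
    show "\<zero>\<^bsub>M\<^esub> \<in> S F"
      using subD(3)[OF K] by (simp add: S_def)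
    show "\<ominus>\<^bsub>M\<^esub> a \<in> S F" if "a \<in> S F" for a
      using that subD(4)[OF K] by (simp add: S_def smult_r_minus)
    show "a \<oplus>\<^bsub>M\<^esub> b \<in> S F" if "a \<in> S F" "b \<in> S F" for a b
      using that subD(5)[OF K] by (simp add: S_def smult_r_distr)
    show "a \<odot>\<^bsub>M\<^esub> b \<in> S F" if "a \<in> carrier R" "b \<in> S F" for a b
      using that subD(6)[OF K] by (simp add: S_def smult_left_commute[of _ a])
  qed
  let ?\<F> = "{F. finite F \<and> F \<subseteq> maximal_colons K}"
  have "\<exists>V\<in>S ` ?\<F>. \<forall>L\<in>S ` ?\<F>. V \<subseteq> L \<longrightarrow> L = V"
    by (rule maximal_conditionD[OF mc]) (use S in auto)
  then obtain F where F: "finite F" "F \<subseteq> maximal_colons K"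
    and max: "\<And>F'. finite F' \<Longrightarrow> F' \<subseteq> maximal_colons K \<Longrightarrow> S F \<subseteq> S F' \<Longrightarrow> S F' = S F"
    by auto
  have "P \<in> F" if P: "P \<in> maximal_colons K" for P
  proof -
    obtain l where l: "l \<in> carrier M" "l \<notin> K" "P = colon K l"
      by (rule maximal_colonE[OF P])
    have "S (insert P F) = S F"
      by (rule max) (use F P in \<open>auto simp: S_def\<close>)
    moreover have "l \<in> S (insert P F)"
      using l by (auto simp: S_def colon_def)
    ultimately have lS: "r \<in> P" if "r \<in> carrier R" "\<forall>Q\<in>F. r \<in> Q" for r
      using that l by (auto simp: S_def colon_def)
    have "\<exists>Q\<in>F. Q \<subseteq> P"
    proof (rule ccontr)
      assume "\<not> ?thesis"
      then have "\<exists>e\<in>carrier R. e \<notin> P \<and> (\<forall>Q\<in>F. e \<in> Q)"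
        using maximal_colon_prime[OF K] F P primeideal.axioms(1)
        by (intro ex_mem_inter_not_mem_prime) blast+
      then show False
        using lS by blast
    qed
    then obtain Q where Q: "Q \<in> F" "Q \<subseteq> P"
      by blast
    have "Q \<in> maximal_colons K"
      using Q F by blast
    then obtain l' where l': "\<forall>l''. l'' \<in> carrier M - K \<longrightarrow> Q \<subseteq> colon K l'' \<longrightarrow> colon K l'' = Q"
      by (rule maximal_colonE)
    then have "P = Q"
      using l Q(2) by blast
    then show ?thesis
      using Q by simp
  qed
  then have "maximal_colons K \<subseteq> F"
    by blast
  then show ?thesis
    using F(1) finite_subset by blast
qed

text \<open>
In both definitions \<open>K\<close> stands for the module \<open>M/K\<close>, which may be zero; regularity is
thus meant in the weak sense, without \<open>xM + K \<noteq> M\<close>.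
\<close>

definition regular_mod :: "'a \<Rightarrow> 'c set \<Rightarrow> bool"
  where "regular_mod x K \<longleftrightarrow> (\<forall>m\<in>carrier M. x \<odot>\<^bsub>M\<^esub> m \<in> K \<longrightarrow> m \<in> K)"

definition no_socle :: "'a set \<Rightarrow> 'c set \<Rightarrow> bool"
  where "no_socle I K \<longleftrightarrow> (\<forall>m\<in>carrier M. (\<forall>r\<in>I. r \<odot>\<^bsub>M\<^esub> m \<in> K) \<longrightarrow> m \<in> K)"

text \<open>
An element that is not regular on \<open>M/K\<close> lies in one of the finitely many maximal annihilators, and none of these
contains both \<open>x\<close> and \<open>J\<close>. Several submodules \<open>K\<close> are allowed because elements that are regular on three
quotients at once are needed below.
\<close>

proposition ex_regular_in_coset:
  assumes R: "noetherian_ring R" and mc: maximal_condition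
    and x: "x \<in> carrier R" and J: "ideal J R"
    and "finite \<K>" and \<K>: "\<And>K. K \<in> \<K> \<Longrightarrow> sub K \<and> no_socle (insert x J) K"
  shows "\<exists>c\<in>J. \<forall>K\<in>\<K>. regular_mod (x \<oplus>\<^bsub>R\<^esub> c) K"
proof -
  have "\<exists>c\<in>J. \<forall>Q\<in>\<Union> (maximal_colons ` \<K>). x \<oplus>\<^bsub>R\<^esub> c \<notin> Q"
  proof (rule ex_add_avoiding_primes[OF x J])
    show "finite (\<Union> (maximal_colons ` \<K>))"
      using \<open>finite \<K>\<close> finite_maximal_colons[OF mc] \<K> by blast
    fix Q assume "Q \<in> \<Union> (maximal_colons ` \<K>)"
    then obtain K where K: "K \<in> \<K>" "Q \<in> maximal_colons K"
      by blast
    obtain l where l: "l \<in> carrier M" "l \<notin> K" "Q = colon K l"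
      by (rule maximal_colonE[OF K(2)])
    have "\<not> insert x J \<subseteq> Q"
      using \<K>[OF K(1)] l by (auto simp: no_socle_def colon_def)
    then show "primeideal Q R \<and> (x \<notin> Q \<or> \<not> J \<subseteq> Q)"
      using maximal_colon_prime \<K> K by blast
  qed
  then obtain c where c: "c \<in> J" "\<forall>K\<in>\<K>. \<forall>Q\<in>maximal_colons K. x \<oplus>\<^bsub>R\<^esub> c \<notin> Q"
    by blast
  have "regular_mod (x \<oplus>\<^bsub>R\<^esub> c) K" if K: "K \<in> \<K>" for K
    unfolding regular_mod_def
  proof (intro ballI impI, rule ccontr)
    fix m assume m: "m \<in> carrier M" "(x \<oplus>\<^bsub>R\<^esub> c) \<odot>\<^bsub>M\<^esub> m \<in> K" "m \<notin> K"
    then obtain P where "P \<in> maximal_colons K" "colon K m \<subseteq> P"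
      using colon_subset_maximal[OF R] \<K>[OF K] by blast
    moreover have "x \<oplus>\<^bsub>R\<^esub> c \<in> colon K m"
      using m x ideal.Icarr[OF J c(1)] by (simp add: colon_def)
    ultimately show False
      using c(2) K by blast
  qed
  then show ?thesis
    using c(1) by blast
qed

end


section \<open>Products of an ideal with a submodule\<close>

context module
begin

lemma span_sub:
  assumes "S \<subseteq> carrier M"
  shows "sub (submodule_span R M S)"
proof (rule submoduleI)
  show "submodule_span R M S \<subseteq> carrier M"
    using carrier_is_submodule assms unfolding submodule_span_def by blast
  show "\<zero>\<^bsub>M\<^esub> \<in> submodule_span R M S"
    unfolding submodule_span_def using subD(3) by blast
  show "\<ominus>\<^bsub>M\<^esub> a \<in> submodule_span R M S" if "a \<in> submodule_span R M S" for a
    using that unfolding submodule_span_def using subD(4) by blast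
  show "a \<oplus>\<^bsub>M\<^esub> b \<in> submodule_span R M S"
    if "a \<in> submodule_span R M S" "b \<in> submodule_span R M S" for a b
    using that unfolding submodule_span_def using subD(5) by blast
  show "r \<odot>\<^bsub>M\<^esub> a \<in> submodule_span R M S"
    if "r \<in> carrier R" "a \<in> submodule_span R M S" for r a
    using that unfolding submodule_span_def using subD(6) by blast
qed

lemma span_upper: "S \<subseteq> submodule_span R M S"
  unfolding submodule_span_def by blast

lemma span_least: "sub H \<Longrightarrow> S \<subseteq> H \<Longrightarrow> submodule_span R M S \<subseteq> H"
  unfolding submodule_span_def by blast

definition ideal_times :: "'a set \<Rightarrow> 'c set \<Rightarrow> 'c set"  (infixr "\<star>" 75)
  where "I \<star> X = submodule_span R M {a \<odot>\<^bsub>M\<^esub> x | a x. a \<in> I \<and> x \<in> X}"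

lemma times_sub:
  assumes "I \<subseteq> carrier R" and "X \<subseteq> carrier M"
  shows "sub (I \<star> X)"
  unfolding ideal_times_def using assms by (intro span_sub) blast

lemma times_mem: "a \<in> I \<Longrightarrow> x \<in> X \<Longrightarrow> a \<odot>\<^bsub>M\<^esub> x \<in> I \<star> X"
  unfolding ideal_times_def by (rule subsetD[OF span_upper]) blast

lemma times_least:
  assumes "sub H" and "\<And>a x. a \<in> I \<Longrightarrow> x \<in> X \<Longrightarrow> a \<odot>\<^bsub>M\<^esub> x \<in> H"
  shows "I \<star> X \<subseteq> H"
  unfolding ideal_times_def using assms by (intro span_least) blast+

lemma times_mono:
  assumes "I \<subseteq> J" "X \<subseteq> Y" "J \<subseteq> carrier R" "Y \<subseteq> carrier M"
  shows "I \<star> X \<subseteq> J \<star> Y"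
proof (rule times_least[OF times_sub[OF assms(3,4)]])
  show "a \<odot>\<^bsub>M\<^esub> x \<in> J \<star> Y" if "a \<in> I" "x \<in> X" for a x
    using that assms by (intro times_mem) auto
qed

lemma times_subset: "sub X \<Longrightarrow> I \<subseteq> carrier R \<Longrightarrow> I \<star> X \<subseteq> X"
  using subD(6) by (intro times_least) blast+

lemma Idl_subset_carrier: "S \<subseteq> carrier R \<Longrightarrow> Idl\<^bsub>R\<^esub> S \<subseteq> carrier R"
  using R.genideal_minimal[OF R.oneideal] .

lemma Idl_times_sub: "S \<subseteq> carrier R \<Longrightarrow> sub X \<Longrightarrow> sub (Idl\<^bsub>R\<^esub> S \<star> X)"
  by (intro times_sub Idl_subset_carrier subD(1))

lemma Idl_times_least:
  assumes S: "S \<subseteq> carrier R" and X: "X \<subseteq> carrier M" and H: "sub H"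
    and mem: "\<And>a x. a \<in> S \<Longrightarrow> x \<in> X \<Longrightarrow> a \<odot>\<^bsub>M\<^esub> x \<in> H"
  shows "Idl\<^bsub>R\<^esub> S \<star> X \<subseteq> H"
proof (rule times_least[OF H])
  fix a x assume a: "a \<in> Idl\<^bsub>R\<^esub> S" and x: "x \<in> X"
  have "S \<subseteq> colon H x"
    using mem x S by (auto simp: colon_def)
  then have "Idl\<^bsub>R\<^esub> S \<subseteq> colon H x"
    using R.genideal_minimal[OF colon_ideal[OF H]] x X by blast
  then show "a \<odot>\<^bsub>M\<^esub> x \<in> H"
    using a by (auto simp: colon_def)
qed

lemma Idl_insert_times:
  assumes x: "x \<in> carrier R" and S: "S \<subseteq> carrier R" and X: "sub X"
  shows "Idl\<^bsub>R\<^esub> (insert x S) \<star> X = x \<cdot> X +\<^sub>M Idl\<^bsub>R\<^esub> S \<star> X"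
proof (rule subset_antisym)
  have ins: "insert x S \<subseteq> Idl\<^bsub>R\<^esub> (insert x S)" "S \<subseteq> Idl\<^bsub>R\<^esub> S"
    using R.genideal_self[of "insert x S"] R.genideal_self[of S] x S by simp_all
  have subs: "sub (x \<cdot> X)" "sub (Idl\<^bsub>R\<^esub> S \<star> X)" "sub (Idl\<^bsub>R\<^esub> (insert x S) \<star> X)"
    using x S X by (simp_all add: multiple_sub Idl_times_sub)
  show "Idl\<^bsub>R\<^esub> (insert x S) \<star> X \<subseteq> x \<cdot> X +\<^sub>M Idl\<^bsub>R\<^esub> S \<star> X"
  proof (rule Idl_times_least[OF _ subD(1)[OF X] sub_sum_closed[OF subs(1,2)]])
    show "insert x S \<subseteq> carrier R"
      using x S by simp
    fix a m assume am: "a \<in> insert x S" "m \<in> X"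
    show "a \<odot>\<^bsub>M\<^esub> m \<in> x \<cdot> X +\<^sub>M Idl\<^bsub>R\<^esub> S \<star> X"
    proof (cases "a = x")
      case True
      then show ?thesis
        using am sum_upper1[OF subs(1,2)] by blast
    next
      case False
      then have "a \<odot>\<^bsub>M\<^esub> m \<in> Idl\<^bsub>R\<^esub> S \<star> X"
        using am ins by (intro times_mem) auto
      then show ?thesis
        using sum_upper2[OF subs(1,2)] by blast
    qed
  qed
  have "x \<cdot> X \<subseteq> Idl\<^bsub>R\<^esub> (insert x S) \<star> X"
    using ins(1) by (auto intro: times_mem)
  moreover have "Idl\<^bsub>R\<^esub> S \<star> X \<subseteq> Idl\<^bsub>R\<^esub> (insert x S) \<star> X"
    using S x subD(1)[OF X] by (intro times_mono R.subset_Idl_subset Idl_subset_carrier) auto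
  ultimately show "x \<cdot> X +\<^sub>M Idl\<^bsub>R\<^esub> S \<star> X \<subseteq> Idl\<^bsub>R\<^esub> (insert x S) \<star> X"
    by (rule sum_least[OF subs(3)])
qed

lemma Idl_empty_times: "sub X \<Longrightarrow> Idl\<^bsub>R\<^esub> {} \<star> X = {\<zero>\<^bsub>M\<^esub>}"
  using Idl_times_least[of "{}" X "{\<zero>\<^bsub>M\<^esub>}"] zero_sub subD[of X] subD(3)[OF Idl_times_sub[of "{}" X]]
  by auto

lemma Idl_singleton_times:
  assumes "x \<in> carrier R" "sub X"
  shows "Idl\<^bsub>R\<^esub> {x} \<star> X = x \<cdot> X"
proof -
  have "Idl\<^bsub>R\<^esub> {x} \<star> X = x \<cdot> X +\<^sub>M {\<zero>\<^bsub>M\<^esub>}"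
    using Idl_insert_times[of x "{}" X] assms by (simp add: Idl_empty_times)
  also have "\<dots> = x \<cdot> X"
    using subD(3)[OF multiple_sub[OF assms]] by (intro sum_absorb multiple_sub zero_sub assms) auto
  finally show ?thesis .
qed

lemma Idl_insert_add:
  assumes x: "x \<in> carrier R" and S: "S \<subseteq> carrier R" and c: "c \<in> Idl\<^bsub>R\<^esub> S"
  shows "Idl\<^bsub>R\<^esub> (insert (x \<oplus>\<^bsub>R\<^esub> c) S) = Idl\<^bsub>R\<^esub> (insert x S)"
proof (rule subset_antisym)
  have cR: "c \<in> carrier R"
    using c Idl_subset_carrier[OF S] by blast
  have I: "ideal (Idl\<^bsub>R\<^esub> (insert y S)) R" "insert y S \<subseteq> Idl\<^bsub>R\<^esub> (insert y S)" "c \<in> Idl\<^bsub>R\<^esub> (insert y S)"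
    if y: "y \<in> carrier R" for y
  proof -
    have yS: "insert y S \<subseteq> carrier R"
      using y S by simp
    show "ideal (Idl\<^bsub>R\<^esub> (insert y S)) R" "insert y S \<subseteq> Idl\<^bsub>R\<^esub> (insert y S)"
      by (rule R.genideal_ideal[OF yS], rule R.genideal_self[OF yS])
    show "c \<in> Idl\<^bsub>R\<^esub> (insert y S)"
      using c R.subset_Idl_subset[OF yS subset_insertI] by blast
  qed
  have xc: "x \<oplus>\<^bsub>R\<^esub> c \<in> carrier R"
    using x cR by simp
  show "Idl\<^bsub>R\<^esub> (insert (x \<oplus>\<^bsub>R\<^esub> c) S) \<subseteq> Idl\<^bsub>R\<^esub> (insert x S)"
    using I[OF x] additive_subgroup.a_closed[OF ideal.axioms(1)[OF I(1)[OF x]], of x c]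
    by (intro R.genideal_minimal) auto
  have "(x \<oplus>\<^bsub>R\<^esub> c) \<ominus>\<^bsub>R\<^esub> c \<in> Idl\<^bsub>R\<^esub> (insert (x \<oplus>\<^bsub>R\<^esub> c) S)"
    using I[OF xc] by (intro R.ideal_minus_closed) auto
  moreover have "(x \<oplus>\<^bsub>R\<^esub> c) \<ominus>\<^bsub>R\<^esub> c = x"
    using x cR by (simp add: R.minus_eq R.a_assoc R.r_neg)
  ultimately show "Idl\<^bsub>R\<^esub> (insert x S) \<subseteq> Idl\<^bsub>R\<^esub> (insert (x \<oplus>\<^bsub>R\<^esub> c) S)"
    using I[OF xc] by (intro R.genideal_minimal) auto
qed

section \<open>Nakayama's lemma at a prime\<close>

text \<open>
Localised at \<open>P\<close>, the hypothesis reads \<open>X \<subseteq> PX + V\<close> and the conclusion \<open>X \<subseteq> V\<close>. Without localising: choose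
\<open>W \<supseteq> V\<close> maximal among the submodules for which the conclusion fails, and \<open>m\<close> in \<open>X\<close> outside \<open>W\<close>.
Then the conclusion holds for \<open>W + Rm\<close>, with \<open>t\<close> say, so \<open>tsm \<in> W + Pm\<close>. Therefore some
\<open>u = ts - p\<close> outside \<open>P\<close> sends \<open>m\<close> into \<open>W\<close>, and \<open>ut\<close> contradicts the choice of \<open>W\<close>.
\<close>

lemma nakayama_at_prime:
  assumes mc: maximal_condition and P: "primeideal P R" and X: "sub X" and V: "sub V"
    and s: "s \<in> carrier R" "s \<notin> P" and sX: "s \<cdot> X \<subseteq> P \<star> X +\<^sub>M V"
  shows "\<exists>t\<in>carrier R. t \<notin> P \<and> t \<cdot> X \<subseteq> V"
proof (rule ccontr)
  assume contr: "\<not> ?thesis"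
  have PR: "P \<subseteq> carrier R" and PI: "ideal P R"
    using primeideal.axioms(1)[OF P] by (auto dest: ideal.Icarr)
  have PX: "sub (P \<star> X)"
    by (rule times_sub[OF PR subD(1)[OF X]])
  let ?F = "{V'. sub V' \<and> V \<subseteq> V' \<and> (\<forall>t\<in>carrier R. t \<notin> P \<longrightarrow> \<not> t \<cdot> X \<subseteq> V')}"
  have "\<exists>K\<in>?F. \<forall>L\<in>?F. K \<subseteq> L \<longrightarrow> L = K"
    by (rule maximal_conditionD[OF mc]) (use V contr in auto)
  then obtain W where W: "sub W" "V \<subseteq> W" "\<And>t. t \<in> carrier R \<Longrightarrow> t \<notin> P \<Longrightarrow> \<not> t \<cdot> X \<subseteq> W"
    and max: "\<And>L. L \<in> ?F \<Longrightarrow> W \<subseteq> L \<Longrightarrow> L = W"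
    by auto
  have "\<one>\<^bsub>R\<^esub> \<notin> P"
    using ideal.one_imp_carrier[OF PI] primeideal.I_notcarr[OF P] by blast
  then have "\<not> \<one>\<^bsub>R\<^esub> \<cdot> X \<subseteq> W"
    using W(3) by simp
  moreover have "\<one>\<^bsub>R\<^esub> \<cdot> X = X"
    using subD(2)[OF X] by force
  ultimately obtain m where m: "m \<in> X" "m \<notin> W"
    by auto
  have mM: "m \<in> carrier M"
    using subD(2)[OF X] m by blast
  let ?W' = "W +\<^sub>M cyclic m"
  have W': "sub ?W'" and WW': "W \<subseteq> ?W'" and mW': "m \<in> ?W'"
    using sub_sum_closed[OF W(1) cyclic_sub[OF mM]] sum_upper1[OF W(1) cyclic_sub[OF mM]]
      sum_upper2[OF W(1) cyclic_sub[OF mM]] self_mem_cyclic[OF mM] by auto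
  have "?W' \<notin> ?F"
    using max[of ?W'] WW' mW' m by auto
  then obtain t where t: "t \<in> carrier R" "t \<notin> P" "t \<cdot> X \<subseteq> ?W'"
    using W' WW' W(2) by auto
  let ?Pm = "(\<lambda>p. p \<odot>\<^bsub>M\<^esub> m) ` P"
  let ?H = "W +\<^sub>M ?Pm"
  have Pm: "sub ?Pm"
    by (rule ideal_multiples_sub[OF PI mM])
  have H: "sub ?H"
    by (rule sub_sum_closed[OF W(1) Pm])
  have WH: "W \<subseteq> ?H"
    by (rule sum_upper1[OF W(1) Pm])
  have "t \<cdot> (P \<star> X) \<subseteq> ?H"
  proof -
    have "P \<star> X \<subseteq> {z \<in> carrier M. t \<odot>\<^bsub>M\<^esub> z \<in> ?H}"
    proof (rule times_least[OF preimage_sub[OF t(1) carrier_is_submodule H]])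
      fix p x assume px: "p \<in> P" "x \<in> X"
      have xM: "x \<in> carrier M" and pR: "p \<in> carrier R"
        using px subD(2)[OF X] PR by auto
      have "t \<odot>\<^bsub>M\<^esub> x \<in> ?W'"
        using t(3) px by blast
      then obtain w y where "w \<in> W" "y \<in> cyclic m" "t \<odot>\<^bsub>M\<^esub> x = w \<oplus>\<^bsub>M\<^esub> y"
        by (rule mem_sumE)
      then obtain r where wr: "w \<in> W" "r \<in> carrier R" "t \<odot>\<^bsub>M\<^esub> x = w \<oplus>\<^bsub>M\<^esub> r \<odot>\<^bsub>M\<^esub> m"
        by (auto simp: cyclic_def)
      have "t \<odot>\<^bsub>M\<^esub> (p \<odot>\<^bsub>M\<^esub> x) = p \<odot>\<^bsub>M\<^esub> w \<oplus>\<^bsub>M\<^esub> (p \<otimes>\<^bsub>R\<^esub> r) \<odot>\<^bsub>M\<^esub> m"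
        unfolding smult_left_commute[OF t(1) pR xM] wr(3)
        using wr pR mM subD(2)[OF W(1)] by (simp add: smult_r_distr smult_assoc1)
      moreover have "p \<odot>\<^bsub>M\<^esub> w \<in> W" "(p \<otimes>\<^bsub>R\<^esub> r) \<odot>\<^bsub>M\<^esub> m \<in> ?Pm"
        using subD(6)[OF W(1) pR wr(1)] ideal.I_r_closed[OF PI px(1) wr(2)] by auto
      ultimately show "p \<odot>\<^bsub>M\<^esub> x \<in> {z \<in> carrier M. t \<odot>\<^bsub>M\<^esub> z \<in> ?H}"
        using pR xM by (auto intro: sum_memI)
    qed
    then show ?thesis
      by auto
  qed
  have "s \<odot>\<^bsub>M\<^esub> m \<in> P \<star> X +\<^sub>M V"
    using sX m by blast
  then obtain z v where zv: "z \<in> P \<star> X" "v \<in> V" "s \<odot>\<^bsub>M\<^esub> m = z \<oplus>\<^bsub>M\<^esub> v"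
    by (rule mem_sumE)
  have zM: "z \<in> carrier M" "v \<in> carrier M"
    using subD(2)[OF PX zv(1)] subD(2)[OF V zv(2)] .
  have "t \<odot>\<^bsub>M\<^esub> v \<in> ?H" "t \<odot>\<^bsub>M\<^esub> z \<in> ?H"
    using subD(6)[OF V t(1) zv(2)] W(2) WH \<open>t \<cdot> (P \<star> X) \<subseteq> ?H\<close> zv(1) by auto
  then have "t \<odot>\<^bsub>M\<^esub> (s \<odot>\<^bsub>M\<^esub> m) \<in> ?H"
    unfolding zv(3) using t(1) zM by (simp add: smult_r_distr subD(5)[OF H])
  then obtain w y where "w \<in> W" "y \<in> ?Pm" "t \<odot>\<^bsub>M\<^esub> (s \<odot>\<^bsub>M\<^esub> m) = w \<oplus>\<^bsub>M\<^esub> y"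
    by (rule mem_sumE)
  then obtain p where wp: "w \<in> W" "p \<in> P" "t \<odot>\<^bsub>M\<^esub> (s \<odot>\<^bsub>M\<^esub> m) = w \<oplus>\<^bsub>M\<^esub> p \<odot>\<^bsub>M\<^esub> m"
    by blast
  have pR: "p \<in> carrier R" and wM: "w \<in> carrier M"
    using wp PR subD(2)[OF W(1)] by auto
  define u where "u = (t \<otimes>\<^bsub>R\<^esub> s) \<ominus>\<^bsub>R\<^esub> p"
  have uR: "u \<in> carrier R"
    using t s pR by (simp add: u_def)
  have "u \<odot>\<^bsub>M\<^esub> m = t \<odot>\<^bsub>M\<^esub> (s \<odot>\<^bsub>M\<^esub> m) \<ominus>\<^bsub>M\<^esub> p \<odot>\<^bsub>M\<^esub> m"
    using t(1) s(1) pR mM by (simp add: u_def R.minus_eq M.minus_eq smult_l_distr smult_l_minus smult_assoc1)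
  also have "\<dots> = w"
    unfolding wp(3) using wM pR mM by (simp add: M.minus_eq M.a_assoc M.r_neg)
  finally have um: "u \<odot>\<^bsub>M\<^esub> m \<in> W"
    using wp(1) by simp
  have "t \<otimes>\<^bsub>R\<^esub> s \<notin> P"
    using primeideal.I_prime[OF P t(1) s(1)] t(2) s(2) by blast
  moreover have "u \<oplus>\<^bsub>R\<^esub> p = t \<otimes>\<^bsub>R\<^esub> s"
    using t(1) s(1) pR by (simp add: u_def R.minus_eq R.a_assoc R.l_neg)
  ultimately have uP: "u \<notin> P"
    using additive_subgroup.a_closed[OF ideal.axioms(1)[OF PI] _ wp(2), of u] by auto
  have "(u \<otimes>\<^bsub>R\<^esub> t) \<cdot> X \<subseteq> W"
  proof
    fix z assume "z \<in> (u \<otimes>\<^bsub>R\<^esub> t) \<cdot> X"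
    then obtain x where x: "x \<in> X" "z = (u \<otimes>\<^bsub>R\<^esub> t) \<odot>\<^bsub>M\<^esub> x"
      by blast
    have xM: "x \<in> carrier M"
      using x subD(2)[OF X] by blast
    have "t \<odot>\<^bsub>M\<^esub> x \<in> ?W'"
      using t(3) x by blast
    then obtain w' y where "w' \<in> W" "y \<in> cyclic m" "t \<odot>\<^bsub>M\<^esub> x = w' \<oplus>\<^bsub>M\<^esub> y"
      by (rule mem_sumE)
    then obtain r where r: "w' \<in> W" "r \<in> carrier R" "t \<odot>\<^bsub>M\<^esub> x = w' \<oplus>\<^bsub>M\<^esub> r \<odot>\<^bsub>M\<^esub> m"
      by (auto simp: cyclic_def)
    have "z = u \<odot>\<^bsub>M\<^esub> (t \<odot>\<^bsub>M\<^esub> x)"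
      using x uR t(1) xM by (simp add: smult_assoc1)
    also have "\<dots> = u \<odot>\<^bsub>M\<^esub> w' \<oplus>\<^bsub>M\<^esub> r \<odot>\<^bsub>M\<^esub> (u \<odot>\<^bsub>M\<^esub> m)"
      unfolding r(3) using r uR mM subD(2)[OF W(1)] by (simp add: smult_r_distr smult_left_commute[of u r])
    finally show "z \<in> W"
      using subD(5)[OF W(1) subD(6)[OF W(1) uR r(1)] subD(6)[OF W(1) r(2) um]] by simp
  qed
  moreover have "u \<otimes>\<^bsub>R\<^esub> t \<notin> P"
    using primeideal.I_prime[OF P uR t(1)] t(2) uP by blast
  ultimately show False
    using W(3)[of "u \<otimes>\<^bsub>R\<^esub> t"] uR t(1) by simp
qed

end


section \<open>Regular elements and socles modulo a submodule\<close>

context module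
begin

text \<open>
The submodule that represents \<open>L/yL\<close> when \<open>K\<close> represents \<open>L = M/K\<close>.
\<close>

abbreviation cut :: "'a \<Rightarrow> 'c set \<Rightarrow> 'c set"
  where "cut y K \<equiv> K +\<^sub>M y \<cdot> carrier M"

lemma cut_sub: "y \<in> carrier R \<Longrightarrow> sub K \<Longrightarrow> sub (cut y K)"
  by (intro sub_sum_closed multiple_sub carrier_is_submodule)

lemma cut_upper: "y \<in> carrier R \<Longrightarrow> sub K \<Longrightarrow> K \<subseteq> cut y K"
  by (intro sum_upper1 multiple_sub carrier_is_submodule)

lemma cut_commute:
  assumes "x \<in> carrier R" "y \<in> carrier R" "sub K"
  shows "cut x (cut y K) = cut y (cut x K)"
proof -
  note subs = assms(3) multiple_sub[OF assms(1) carrier_is_submodule] multiple_sub[OF assms(2) carrier_is_submodule]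
  have "cut x (cut y K) = K +\<^sub>M (y \<cdot> carrier M +\<^sub>M x \<cdot> carrier M)"
    by (rule sum_assoc[OF subs(1,3,2)])
  also have "y \<cdot> carrier M +\<^sub>M x \<cdot> carrier M = x \<cdot> carrier M +\<^sub>M y \<cdot> carrier M"
    by (rule sum_commute[OF subs(3,2)])
  also have "K +\<^sub>M (x \<cdot> carrier M +\<^sub>M y \<cdot> carrier M) = cut y (cut x K)"
    by (rule sum_assoc[OF subs(1,2,3), symmetric])
  finally show ?thesis .
qed

lemma mem_cutE:
  assumes "m \<in> cut y K"
  obtains k l where "k \<in> K" "l \<in> carrier M" "m = k \<oplus>\<^bsub>M\<^esub> y \<odot>\<^bsub>M\<^esub> l"
  using assms unfolding mem_sum_iff by blast

lemma mem_cutI: "k \<in> K \<Longrightarrow> l \<in> carrier M \<Longrightarrow> k \<oplus>\<^bsub>M\<^esub> y \<odot>\<^bsub>M\<^esub> l \<in> cut y K"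
  by (intro sum_memI imageI)

lemma regular_cancel:
  assumes K: "sub K" and y: "y \<in> carrier R" "regular_mod y K"
    and p: "p \<in> K" and q: "q \<in> K" and u: "u \<in> carrier M" and v: "v \<in> carrier M"
    and eq: "p \<oplus>\<^bsub>M\<^esub> y \<odot>\<^bsub>M\<^esub> u = q \<oplus>\<^bsub>M\<^esub> y \<odot>\<^bsub>M\<^esub> v"
  obtains k where "k \<in> K" "v = k \<oplus>\<^bsub>M\<^esub> u"
proof -
  have "y \<odot>\<^bsub>M\<^esub> (v \<ominus>\<^bsub>M\<^esub> u) = y \<odot>\<^bsub>M\<^esub> v \<ominus>\<^bsub>M\<^esub> y \<odot>\<^bsub>M\<^esub> u"
    using y u v by (simp add: M.minus_eq smult_r_distr smult_r_minus)
  also have "\<dots> \<in> K"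
    using diff_mem[OF K p q _ _ eq] y u v by simp
  finally have "v \<ominus>\<^bsub>M\<^esub> u \<in> K"
    using y(2) u v by (simp add: regular_mod_def)
  moreover have "v = (v \<ominus>\<^bsub>M\<^esub> u) \<oplus>\<^bsub>M\<^esub> u"
    using u v by (simp add: M.minus_eq M.a_assoc M.l_neg)
  ultimately show ?thesis
    by (rule that)
qed

text \<open>
One half of the exchange of two elements \<open>a, c\<close> of a regular sequence: if \<open>al = cl'\<close> in \<open>M/K\<close>, then
\<open>l' = al''\<close>, and \<open>a\<close> can be cancelled. The other half, that \<open>c\<close> is regular on \<open>M/K\<close> itself, is arranged by
the choice of \<open>c\<close> wherever the lemma is used.
\<close>

lemma regular_swap:
  assumes K: "sub K" and a: "a \<in> carrier R" "regular_mod a K"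
    and c: "c \<in> carrier R" "regular_mod c (cut a K)"
  shows "regular_mod a (cut c K)"
  unfolding regular_mod_def
proof (intro ballI impI)
  fix l assume l: "l \<in> carrier M" "a \<odot>\<^bsub>M\<^esub> l \<in> cut c K"
  then obtain k l' where k: "k \<in> K" "l' \<in> carrier M" "a \<odot>\<^bsub>M\<^esub> l = k \<oplus>\<^bsub>M\<^esub> c \<odot>\<^bsub>M\<^esub> l'"
    by (elim mem_cutE)
  have kM: "k \<in> carrier M"
    using subD(2)[OF K k(1)] .
  have "c \<odot>\<^bsub>M\<^esub> l' \<in> cut a K"
  proof (rule add_mem_cancel[OF cut_sub[OF a(1) K]])
    show "k \<in> cut a K"
      using cut_upper[OF a(1) K] k(1) by blast
    have "\<zero>\<^bsub>M\<^esub> \<oplus>\<^bsub>M\<^esub> a \<odot>\<^bsub>M\<^esub> l \<in> cut a K"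
      by (rule mem_cutI[OF subD(3)[OF K] l(1)])
    then show "k \<oplus>\<^bsub>M\<^esub> c \<odot>\<^bsub>M\<^esub> l' \<in> cut a K"
      using k(2,3) l(1) a(1) c(1) kM by simp
  qed (use c k in simp)
  then have "l' \<in> cut a K"
    using c(2) k(2) by (simp add: regular_mod_def)
  then obtain k' l'' where k': "k' \<in> K" "l'' \<in> carrier M" "l' = k' \<oplus>\<^bsub>M\<^esub> a \<odot>\<^bsub>M\<^esub> l''"
    by (rule mem_cutE)
  have k'M: "k' \<in> carrier M"
    using subD(2)[OF K k'(1)] .
  have eq: "(k \<oplus>\<^bsub>M\<^esub> c \<odot>\<^bsub>M\<^esub> k') \<oplus>\<^bsub>M\<^esub> a \<odot>\<^bsub>M\<^esub> (c \<odot>\<^bsub>M\<^esub> l'') = \<zero>\<^bsub>M\<^esub> \<oplus>\<^bsub>M\<^esub> a \<odot>\<^bsub>M\<^esub> l"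
    unfolding k(3) k'(3) using k' kM k'M a(1) c(1)
    by (simp add: smult_r_distr smult_left_commute[of a c] M.a_assoc)
  obtain k2 where "k2 \<in> K" "l = k2 \<oplus>\<^bsub>M\<^esub> c \<odot>\<^bsub>M\<^esub> l''"
    by (rule regular_cancel[OF K a _ subD(3)[OF K] _ l(1) eq])
      (use subD(5)[OF K k(1) subD(6)[OF K c(1) k'(1)]] c(1) k'(2) in auto)
  then show "l \<in> cut c K"
    using k'(2) by (simp add: mem_cutI)
qed

lemma no_socle_of_regular:
  assumes "a \<in> I" "regular_mod a K"
  shows "no_socle I K"
  using assms by (auto simp: no_socle_def regular_mod_def)

text \<open>
For \<open>l\<close> in \<open>L = M/K\<close> with \<open>Il \<subseteq> yL\<close>, write \<open>al = yl'\<close>. Then \<open>Il' \<subseteq> aL\<close>, because \<open>y\<close> can be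
cancelled in \<open>yIl' = aIl \<subseteq> ayL\<close>; and \<open>l' \<in> aL\<close> gives \<open>al \<in> ayL\<close>, whence \<open>l \<in> yL\<close>. For \<open>y \<in> I\<close> this is
the comparison of \<open>Hom(R/I, L/yL)\<close> and \<open>Hom(R/I, L/aL)\<close>, both isomorphic to \<open>Ext\<^sup>1(R/I, L)\<close>.
\<close>

lemma no_socle_exchange:
  assumes K: "sub K" and I: "I \<subseteq> carrier R"
    and a: "a \<in> I" "regular_mod a K" and y: "y \<in> carrier R" "regular_mod y K"
    and soc: "no_socle I (cut a K)"
  shows "no_socle I (cut y K)"
  unfolding no_socle_def
proof (intro ballI impI)
  fix l assume l: "l \<in> carrier M" "\<forall>r\<in>I. r \<odot>\<^bsub>M\<^esub> l \<in> cut y K"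
  have aR: "a \<in> carrier R"
    using a I by blast
  obtain k l' where k: "k \<in> K" "l' \<in> carrier M" "a \<odot>\<^bsub>M\<^esub> l = k \<oplus>\<^bsub>M\<^esub> y \<odot>\<^bsub>M\<^esub> l'"
    using l(2) a(1) by (blast elim: mem_cutE)
  have kM: "k \<in> carrier M"
    using subD(2)[OF K k(1)] .
  have "r \<odot>\<^bsub>M\<^esub> l' \<in> cut a K" if r: "r \<in> I" for r
  proof -
    have rR: "r \<in> carrier R"
      using r I by blast
    obtain k1 m1 where k1: "k1 \<in> K" "m1 \<in> carrier M" "r \<odot>\<^bsub>M\<^esub> l = k1 \<oplus>\<^bsub>M\<^esub> y \<odot>\<^bsub>M\<^esub> m1"
      using l(2) r by (blast elim: mem_cutE)
    have k1M: "k1 \<in> carrier M"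
      using subD(2)[OF K k1(1)] .
    have "a \<odot>\<^bsub>M\<^esub> k1 \<oplus>\<^bsub>M\<^esub> y \<odot>\<^bsub>M\<^esub> (a \<odot>\<^bsub>M\<^esub> m1) = a \<odot>\<^bsub>M\<^esub> (r \<odot>\<^bsub>M\<^esub> l)"
      unfolding k1(3) using k1 k1M aR y(1) by (simp add: smult_r_distr smult_left_commute[of a y])
    also have "\<dots> = r \<odot>\<^bsub>M\<^esub> (a \<odot>\<^bsub>M\<^esub> l)"
      by (rule smult_left_commute[OF aR rR l(1)])
    also have "\<dots> = r \<odot>\<^bsub>M\<^esub> k \<oplus>\<^bsub>M\<^esub> y \<odot>\<^bsub>M\<^esub> (r \<odot>\<^bsub>M\<^esub> l')"
      unfolding k(3) using k kM rR y(1) by (simp add: smult_r_distr smult_left_commute[of r y])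
    finally have eq: "a \<odot>\<^bsub>M\<^esub> k1 \<oplus>\<^bsub>M\<^esub> y \<odot>\<^bsub>M\<^esub> (a \<odot>\<^bsub>M\<^esub> m1) = r \<odot>\<^bsub>M\<^esub> k \<oplus>\<^bsub>M\<^esub> y \<odot>\<^bsub>M\<^esub> (r \<odot>\<^bsub>M\<^esub> l')" .
    obtain k2 where "k2 \<in> K" "r \<odot>\<^bsub>M\<^esub> l' = k2 \<oplus>\<^bsub>M\<^esub> a \<odot>\<^bsub>M\<^esub> m1"
      by (rule regular_cancel[OF K y subD(6)[OF K aR k1(1)] subD(6)[OF K rR k(1)] _ _ eq])
        (use aR rR k1 k in auto)
    then show ?thesis
      using k1(2) by (simp add: mem_cutI)
  qed
  then have "l' \<in> cut a K"
    using soc k(2) unfolding no_socle_def by blast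
  then obtain k2 m2 where k2: "k2 \<in> K" "m2 \<in> carrier M" "l' = k2 \<oplus>\<^bsub>M\<^esub> a \<odot>\<^bsub>M\<^esub> m2"
    by (rule mem_cutE)
  have k2M: "k2 \<in> carrier M"
    using subD(2)[OF K k2(1)] .
  have eq: "(k \<oplus>\<^bsub>M\<^esub> y \<odot>\<^bsub>M\<^esub> k2) \<oplus>\<^bsub>M\<^esub> a \<odot>\<^bsub>M\<^esub> (y \<odot>\<^bsub>M\<^esub> m2) = \<zero>\<^bsub>M\<^esub> \<oplus>\<^bsub>M\<^esub> a \<odot>\<^bsub>M\<^esub> l"
    unfolding k(3) k2(3) using k2 kM k2M aR y(1)
    by (simp add: smult_r_distr smult_left_commute[of a y] M.a_assoc)
  obtain k3 where "k3 \<in> K" "l = k3 \<oplus>\<^bsub>M\<^esub> y \<odot>\<^bsub>M\<^esub> m2"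
    by (rule regular_cancel[OF K aR a(2) _ subD(3)[OF K] _ l(1) eq])
      (use subD(5)[OF K k(1) subD(6)[OF K y(1) k2(1)]] y(1) k2(2) in auto)
  then show "l \<in> cut y K"
    using k2(2) by (simp add: mem_cutI)
qed

section \<open>Depth independent of the chosen regular sequence\<close>

text \<open>
The module \<open>M/K\<close> has depth at least \<open>r\<close> along \<open>I\<close>, in the form in which it is used: at each of the first
\<open>r\<close> steps no nonzero element is killed by \<open>I\<close>, whichever regular elements of \<open>I\<close> have been divided out before.
\<close>

primrec deep :: "'a set \<Rightarrow> nat \<Rightarrow> 'c set \<Rightarrow> bool"
  where
    "deep I 0 K \<longleftrightarrow> True"
  | "deep I (Suc r) K \<longleftrightarrow> no_socle I K \<and> (\<forall>y\<in>I. regular_mod y K \<longrightarrow> deep I r (cut y K))"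

text \<open>
A single good choice \<open>a\<close> is enough: every other regular \<open>y\<close> does as well. Take \<open>c \<in> I\<close> that is regular on
\<open>L\<close>, \<open>L/aL\<close> and \<open>L/yL\<close>. Depth passes from \<open>L/aL\<close> down to \<open>L/(a, c)L\<close>, by induction up to \<open>L/cL\<close>,
down again to \<open>L/(c, y)L\<close>, and by induction up to \<open>L/yL\<close>; each step down loses one, each step up regains it.
\<close>

proposition deep_of_regular:
  assumes R: "noetherian_ring R" and mc: maximal_condition and I: "ideal I R"
    and K: "sub K" and a: "a \<in> I" "regular_mod a K" and deep: "deep I r (cut a K)"
  shows "deep I (Suc r) K"
  using K a deep
proof (induction r arbitrary: K a)
  case 0
  then show ?case
    by (simp add: no_socle_of_regular)
next
  case (Suc r)
  note K = \<open>sub K\<close> and a = \<open>a \<in> I\<close> \<open>regular_mod a K\<close>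
  have IR: "I \<subseteq> carrier R"
    using ideal.Icarr[OF I] by blast
  have aR: "a \<in> carrier R"
    using a IR by blast
  have soc: "no_socle I K"
    using no_socle_of_regular a .
  have soc_a: "no_socle I (cut a K)"
    using Suc.prems(4) by simp
  have "deep I (Suc r) (cut y K)" if y: "y \<in> I" "regular_mod y K" for y
  proof -
    have yR: "y \<in> carrier R"
      using y IR by blast
    have soc_y: "no_socle I (cut y K)"
      by (rule no_socle_exchange[OF K IR a yR y(2) soc_a])
    have "\<exists>c\<in>I. \<forall>L\<in>{K, cut a K, cut y K}. regular_mod (\<zero>\<^bsub>R\<^esub> \<oplus>\<^bsub>R\<^esub> c) L"
    proof (rule ex_regular_in_coset[OF R mc R.zero_closed I])
      fix L assume L: "L \<in> {K, cut a K, cut y K}"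
      have "sub L"
        using L K cut_sub[OF aR K] cut_sub[OF yR K] by blast
      moreover have "no_socle I L"
        using L soc soc_a soc_y by blast
      ultimately show "sub L \<and> no_socle (insert \<zero>\<^bsub>R\<^esub> I) L"
        unfolding no_socle_def by blast
    qed simp
    then obtain c where c: "c \<in> I" "regular_mod c K" "regular_mod c (cut a K)" "regular_mod c (cut y K)"
      using IR by auto
    have cR: "c \<in> carrier R"
      using c IR by blast
    have Kc: "sub (cut c K)"
      by (rule cut_sub[OF cR K])
    have "deep I r (cut c (cut a K))"
      using Suc.prems(4) c by simp
    then have "deep I r (cut a (cut c K))"
      by (simp only: cut_commute[OF cR aR K])
    then have "deep I (Suc r) (cut c K)"
      using Suc.IH[OF Kc a(1)] regular_swap[OF K aR a(2) cR c(3)] by blast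
    moreover have "regular_mod y (cut c K)"
      by (rule regular_swap[OF K yR y(2) cR c(4)])
    ultimately have "deep I r (cut y (cut c K))"
      using y(1) by simp
    then have "deep I r (cut c (cut y K))"
      by (simp only: cut_commute[OF yR cR K])
    then show ?thesis
      using Suc.IH[OF cut_sub[OF yR K] c(1) c(4)] by blast
  qed
  then show ?case
    using soc by (simp only: deep.simps(2)) blast
qed

end

section \<open>Socles with respect to ideals of definition\<close>

lemma (in local_ring) proper_ideal_subset:
  assumes R: "noetherian_ring R" and J: "ideal J R" "\<one> \<notin> J"
  shows "J \<subseteq> \<mm>"
proof -
  interpret noetherian_ring R
    by fact
  have "\<exists>I\<in>{I. ideal I R \<and> J \<subseteq> I \<and> \<one> \<notin> I}. \<forall>I'\<in>{I. ideal I R \<and> J \<subseteq> I \<and> \<one> \<notin> I}. I \<subseteq> I' \<longrightarrow> I' = I"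
    by (rule ex_maximal_ideal_in) (use J in auto)
  then obtain I where I: "ideal I R" "J \<subseteq> I" "\<one> \<notin> I"
    and max: "\<And>I'. ideal I' R \<Longrightarrow> J \<subseteq> I' \<Longrightarrow> \<one> \<notin> I' \<Longrightarrow> I \<subseteq> I' \<Longrightarrow> I' = I"
    by auto
  have "maximalideal I R"
  proof (rule maximalidealI[OF I(1)])
    show "carrier R \<noteq> I"
      using I(3) by auto
    fix L assume L: "ideal L R" "I \<subseteq> L" "L \<subseteq> carrier R"
    show "L = I \<or> L = carrier R"
    proof (cases "\<one> \<in> L")
      case True
      then show ?thesis
        using ideal.one_imp_carrier[OF L(1)] by simp
    next
      case False
      then show ?thesis
        using max[OF L(1) _ False L(2)] I(2) L(2) by auto
    qed
  qed
  then show ?thesis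
    using maximal_unique I(2) by simp
qed

context module
begin

text \<open>
Elements outside \<open>\<mm>\<close> act invertibly on every quotient of \<open>M\<close>.
\<close>

lemma mem_of_multiple_mem:
  assumes R: "noetherian_ring R" and loc: "local_ring \<mm> R"
    and V: "sub V" and t: "t \<in> carrier R" "t \<notin> \<mm>" and x: "x \<in> carrier M" "t \<odot>\<^bsub>M\<^esub> x \<in> V"
  shows "x \<in> V"
proof (rule ccontr)
  assume "x \<notin> V"
  then have "\<one>\<^bsub>R\<^esub> \<notin> colon V x"
    using x by (simp add: colon_def)
  then have "colon V x \<subseteq> \<mm>"
    by (rule local_ring.proper_ideal_subset[OF loc R colon_ideal[OF V x(1)]])
  then show False
    using t x by (auto simp: colon_def)
qed

lemma finite_length_stabilises:
  assumes fin: "len V B \<noteq> \<infinity>"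
    and X: "\<And>k::nat. sub (X k) \<and> V \<subseteq> X k \<and> X k \<subseteq> B" and dec: "\<And>k. X (Suc k) \<subseteq> X k"
  shows "\<exists>k. X (Suc k) = X k"
proof (rule ccontr)
  assume "\<not> ?thesis"
  then have strict: "X (Suc k) \<subset> X k" for k
    using dec[of k] by auto
  have "has_chain R M V B n" for n
    unfolding has_chain_def
  proof (intro exI[of _ "\<lambda>i. X (n - i)"] conjI allI impI)
    show "X (n - i) \<subset> X (n - Suc i)" if "i < n" for i
      using strict[of "n - Suc i"] that by (simp add: Suc_diff_Suc)
  qed (use X in auto)
  then have "enat n \<le> len V B" for n
    by (rule le_interval_length)
  then show False
    using fin by (metis enat_ord_simps(1) not_enat_eq Suc_n_not_le_n)
qed

text \<open>
If \<open>I\<close> kills a nonzero element of \<open>M/N\<close>, then \<open>I \<subseteq> P\<close> for some prime \<open>P\<close> that is the annihilator of an element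
of \<open>M/N\<close>. To see that \<open>\<mm> \<subseteq> P\<close>, let \<open>a \<in> \<mm>\<close>. By finite length and Nakayama's lemma
\<open>a\<^sup>k M \<subseteq> U + IM \<subseteq> U + PM\<close> for some \<open>k\<close>. If \<open>a \<notin> P\<close>, Nakayama's lemma at \<open>P\<close> provides \<open>t \<notin> P\<close> with
\<open>tM \<subseteq> U \<subseteq> N\<close>; but an element that kills \<open>M/N\<close> lies in \<open>P\<close>.
\<close>

lemma no_socle_of_finite_length:
  assumes R: "noetherian_ring R" and mc: maximal_condition and loc: "local_ring \<mm> R"
    and I: "I \<subseteq> carrier R" and U: "sub U" and N: "sub N" and UN: "U \<subseteq> N"
    and fin: "len (U +\<^sub>M I \<star> carrier M) (carrier M) \<noteq> \<infinity>"
    and soc: "no_socle \<mm> N"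
  shows "no_socle I N"
  unfolding no_socle_def
proof (intro ballI impI, rule ccontr)
  fix l assume l: "l \<in> carrier M" "\<forall>r\<in>I. r \<odot>\<^bsub>M\<^esub> l \<in> N" "l \<notin> N"
  interpret local_ring \<mm> R
    by fact
  have mP: "primeideal \<mm> R"
    by (rule R.maximalideal_prime[OF is_maximalideal])
  have mR: "\<mm> \<subseteq> carrier R"
    using a_Hcarr by blast
  have MM: "sub (carrier M)"
    by (rule carrier_is_submodule)
  let ?V = "U +\<^sub>M I \<star> carrier M"
  have IM: "sub (I \<star> carrier M)"
    by (rule times_sub[OF I order_refl])
  have V: "sub ?V"
    by (rule sub_sum_closed[OF U IM])
  obtain P where P: "P \<in> maximal_colons N" "colon N l \<subseteq> P"
    using colon_subset_maximal[OF R N l(1,3)] by blast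
  have PP: "primeideal P R"
    by (rule maximal_colon_prime[OF N P(1)])
  obtain l' where l': "l' \<in> carrier M" "l' \<notin> N" "P = colon N l'"
    by (rule maximal_colonE[OF P(1)])
  have PR: "P \<subseteq> carrier R"
    unfolding l'(3) by (auto simp: colon_def)
  have IP: "I \<subseteq> P"
    using P(2) l(2) I by (auto simp: colon_def)
  have "\<mm> \<subseteq> P"
  proof (rule subsetI, rule ccontr)
    fix a assume a: "a \<in> \<mm>" "a \<notin> P"
    have aR: "a \<in> carrier R"
      using a mR by blast
    \<comment> \<open>The decreasing submodules \<open>X k = a\<^sup>k M + V\<close>, where \<open>V = U + IM\<close>.\<close>
    define X where "X k = ((\<lambda>X. a \<cdot> X +\<^sub>M ?V) ^^ k) (carrier M)" for k :: nat
    have X_Suc: "X (Suc k) = a \<cdot> X k +\<^sub>M ?V" for k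
      by (simp add: X_def)
    have X: "sub (X k) \<and> ?V \<subseteq> X k" for k
    proof (induction k)
      case 0
      then show ?case
        using MM subD(1)[OF V] by (simp add: X_def)
    next
      case (Suc k)
      then show ?case
        unfolding X_Suc using sub_sum_closed[OF multiple_sub[OF aR] V] sum_upper2[OF multiple_sub[OF aR] V] by blast
    qed
    have dec: "X (Suc k) \<subseteq> X k" for k
      unfolding X_Suc using X[of k] multiple_subset[OF aR, of "X k"] by (simp add: sum_least)
    obtain k where k: "X (Suc k) = X k"
    proof -
      have "sub (X k) \<and> ?V \<subseteq> X k \<and> X k \<subseteq> carrier M" for k
        using X[of k] subD(1)[of "X k"] by simp
      then show ?thesis
        using finite_length_stabilises[of ?V "carrier M" X, OF fin] dec that by blast
    qed
    have "\<one>\<^bsub>R\<^esub> \<cdot> X k \<subseteq> \<mm> \<star> X k +\<^sub>M ?V"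
    proof -
      have "\<one>\<^bsub>R\<^esub> \<cdot> X k \<subseteq> X k"
        using X by (intro multiple_subset) auto
      also have "X k = a \<cdot> X k +\<^sub>M ?V"
        using k X_Suc by simp
      also have "\<dots> \<subseteq> \<mm> \<star> X k +\<^sub>M ?V"
        using a(1) by (intro sum_mono) (auto intro: times_mem)
      finally show ?thesis .
    qed
    moreover have "\<one>\<^bsub>R\<^esub> \<notin> \<mm>"
      using one_imp_carrier I_notcarr by blast
    ultimately obtain t where t: "t \<in> carrier R" "t \<notin> \<mm>" "t \<cdot> X k \<subseteq> ?V"
      using nakayama_at_prime[OF mc mP _ V R.one_closed] X by blast
    have XV: "X k \<subseteq> ?V"
    proof
      fix x assume "x \<in> X k"
      then show "x \<in> ?V"
        using mem_of_multiple_mem[OF R loc V t(1,2)] t(3) X subD(2) by blast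
    qed
    \<comment> \<open>The element \<open>s\<close> is \<open>a\<^sup>j\<close>.\<close>
    have "\<exists>s\<in>carrier R. s \<notin> P \<and> s \<cdot> carrier M \<subseteq> X j" for j
    proof (induction j)
      case 0
      have "\<one>\<^bsub>R\<^esub> \<notin> P"
        using l' by (simp add: colon_def)
      then show ?case
        by (intro bexI[of _ "\<one>\<^bsub>R\<^esub>"]) (auto simp: X_def)
    next
      case (Suc j)
      then obtain s where s: "s \<in> carrier R" "s \<notin> P" "s \<cdot> carrier M \<subseteq> X j"
        by blast
      have "a \<otimes>\<^bsub>R\<^esub> s \<notin> P"
        using primeideal.I_prime[OF PP aR s(1)] a s by blast
      moreover have "(a \<otimes>\<^bsub>R\<^esub> s) \<cdot> carrier M \<subseteq> a \<cdot> X j"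
        using s aR by (auto simp: smult_assoc1)
      moreover have "a \<cdot> X j \<subseteq> X (Suc j)"
        unfolding X_Suc using X by (intro sum_upper1 multiple_sub aR V) blast
      ultimately show ?case
        using aR s(1) by (intro bexI[of _ "a \<otimes>\<^bsub>R\<^esub> s"]) auto
    qed
    then obtain s where s: "s \<in> carrier R" "s \<notin> P" "s \<cdot> carrier M \<subseteq> X k"
      by blast
    have "?V \<subseteq> P \<star> carrier M +\<^sub>M U"
      unfolding sum_commute[OF times_sub[OF PR order_refl] U]
      by (intro sum_mono times_mono order_refl IP PR)
    then have "s \<cdot> carrier M \<subseteq> P \<star> carrier M +\<^sub>M U"
      using s(3) XV by blast
    then obtain t where t: "t \<in> carrier R" "t \<notin> P" "t \<cdot> carrier M \<subseteq> U"
      using nakayama_at_prime[OF mc PP MM U s(1,2)] by blast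
    then have "t \<odot>\<^bsub>M\<^esub> l' \<in> N"
      using l'(1) UN by blast
    then show False
      using t l'(3) by (simp add: colon_def)
  qed
  then show False
    using soc l' by (auto simp: no_socle_def colon_def)
qed

section \<open>Several parameters\<close>

lemma inter_multiple_regular:
  assumes N: "sub N" and y: "y \<in> carrier R" "regular_mod y N"
  shows "y \<cdot> carrier M \<inter> N = y \<cdot> N"
proof (rule subset_antisym)
  show "y \<cdot> carrier M \<inter> N \<subseteq> y \<cdot> N"
    using y(2) unfolding regular_mod_def by blast
  show "y \<cdot> N \<subseteq> y \<cdot> carrier M \<inter> N"
    using subD(1)[OF N] multiple_subset[OF y(1) N] by blast
qed

text \<open>
The submodules \<open>N\<close> and \<open>M\<close> are considered modulo \<open>U\<close>, which collects the multiples \<open>yM\<close> of the parameters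
already divided out. In the induction step a parameter \<open>y\<close> that is regular on \<open>M/N\<close> moves from the ideal into
\<open>U\<close>, and \<open>N\<close> becomes \<open>N + yM\<close>. This replaces \<open>N\<close> by its image modulo \<open>yM\<close>; as \<open>N \<inter> yM = yN\<close>,
the quotient whose length is to be bounded does not become smaller.
\<close>

theorem length_mod_parameters:
  assumes R: "noetherian_ring R" and mc: maximal_condition and loc: "local_ring \<mm> R"
    and "set zs \<subseteq> \<mm>" and "length zs = Suc r"
    and "sub U" and "sub N" and "U \<subseteq> N" and "deep \<mm> r N"
  shows "len (U +\<^sub>M Idl\<^bsub>R\<^esub> (set zs) \<star> N) N \<le> len (U +\<^sub>M Idl\<^bsub>R\<^esub> (set zs) \<star> carrier M) (carrier M)"
  using assms(4-)
proof (induction r arbitrary: zs U N)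
  case 0
  interpret local_ring \<mm> R
    by fact
  obtain z where z: "zs = [z]"
    using 0 by (auto simp: length_Suc_conv)
  have zR: "z \<in> carrier R"
    using 0 z a_Hcarr by auto
  have comm: "U +\<^sub>M Idl\<^bsub>R\<^esub> (set zs) \<star> X = z \<cdot> X +\<^sub>M U" if X: "sub X" for X
    using Idl_singleton_times[OF zR X] sum_commute[OF \<open>sub U\<close> multiple_sub[OF zR X]] by (simp add: z)
  show ?case
    unfolding comm[OF \<open>sub N\<close>] comm[OF carrier_is_submodule]
    by (rule length_mod_one_parameter[OF mc zR]) (use 0 in auto)
next
  case (Suc r)
  interpret local_ring \<mm> R
    by fact
  note U = \<open>sub U\<close> and N = \<open>sub N\<close> and UN = \<open>U \<subseteq> N\<close>
  have MM: "sub (carrier M)"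
    by (rule carrier_is_submodule)
  obtain z zs' where zs: "zs = z # zs'" "length zs' = Suc r"
    using Suc.prems(2) by (auto simp: length_Suc_conv)
  define S where "S = set zs'"
  have mR: "\<mm> \<subseteq> carrier R"
    using a_Hcarr by blast
  have z: "z \<in> \<mm>" "z \<in> carrier R" and S: "S \<subseteq> \<mm>" "S \<subseteq> carrier R" and set_zs: "set zs = insert z S"
    using Suc.prems(1) mR by (auto simp: zs S_def)
  have zsR: "insert z S \<subseteq> carrier R"
    using z S by simp
  let ?q = "Idl\<^bsub>R\<^esub> (set zs)"
  show ?case
  proof (cases "len (U +\<^sub>M ?q \<star> carrier M) (carrier M) = \<infinity>")
    case False
    have J: "ideal (Idl\<^bsub>R\<^esub> S) R"
      by (rule R.genideal_ideal[OF S(2)])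
    have soc: "no_socle ?q N"
      using Suc.prems by (intro no_socle_of_finite_length[OF R mc loc _ U N UN False])
        (auto simp: set_zs intro: Idl_subset_carrier[OF zsR, THEN subsetD])
    have soc': "no_socle (insert z (Idl\<^bsub>R\<^esub> S)) N"
      unfolding no_socle_def
    proof (intro ballI impI)
      fix m assume m: "m \<in> carrier M" "\<forall>r\<in>insert z (Idl\<^bsub>R\<^esub> S). r \<odot>\<^bsub>M\<^esub> m \<in> N"
      have "insert z S \<subseteq> colon N m"
        using m zsR R.genideal_self[OF S(2)] by (auto simp: colon_def)
      then have "?q \<subseteq> colon N m"
        unfolding set_zs by (rule R.genideal_minimal[OF colon_ideal[OF N m(1)]])
      then show "m \<in> N"
        using soc m(1) by (auto simp: no_socle_def colon_def)
    qed
    have "\<exists>c\<in>Idl\<^bsub>R\<^esub> S. \<forall>K\<in>{N}. regular_mod (z \<oplus>\<^bsub>R\<^esub> c) K"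
      by (rule ex_regular_in_coset[OF R mc z(2) J]) (use soc' N in auto)
    then obtain c where c: "c \<in> Idl\<^bsub>R\<^esub> S" "regular_mod (z \<oplus>\<^bsub>R\<^esub> c) N"
      by blast
    define y where "y = z \<oplus>\<^bsub>R\<^esub> c"
    have cm: "c \<in> \<mm>"
      using R.genideal_minimal[OF is_ideal S(1)] c(1) by blast
    have y: "y \<in> \<mm>" "regular_mod y N"
      using z(1) cm c(2) by (simp_all add: y_def)
    have yR: "y \<in> carrier R"
      using y mR by blast
    have q: "?q = Idl\<^bsub>R\<^esub> (insert y S)"
      unfolding y_def set_zs by (rule Idl_insert_add[OF z(2) S(2) c(1), symmetric])
    have q_times: "?q \<star> X = y \<cdot> X +\<^sub>M Idl\<^bsub>R\<^esub> S \<star> X" if "sub X" for X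
      unfolding q by (rule Idl_insert_times[OF yR S(2) that])
    let ?U' = "cut y U" and ?N' = "cut y N"
    have U': "sub ?U'" and N': "sub ?N'"
      by (rule cut_sub[OF yR U], rule cut_sub[OF yR N])
    have yM: "sub (y \<cdot> carrier M)" and yN: "sub (y \<cdot> N)"
      by (rule multiple_sub[OF yR MM], rule multiple_sub[OF yR N])
    have SN: "sub (Idl\<^bsub>R\<^esub> S \<star> N)" and SN': "sub (Idl\<^bsub>R\<^esub> S \<star> ?N')" and SM: "sub (Idl\<^bsub>R\<^esub> S \<star> carrier M)"
      by (intro Idl_times_sub S(2) N N' MM)+
    have IH: "len (?U' +\<^sub>M Idl\<^bsub>R\<^esub> S \<star> ?N') ?N' \<le> len (?U' +\<^sub>M Idl\<^bsub>R\<^esub> S \<star> carrier M) (carrier M)"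
      unfolding S_def
    proof (rule Suc.IH[OF _ zs(2) U' N'])
      show "set zs' \<subseteq> \<mm>"
        using S(1) by (simp add: S_def)
      show "?U' \<subseteq> ?N'"
        by (rule sum_mono[OF UN order_refl])
      show "deep \<mm> r ?N'"
        using Suc.prems(6) y by simp
    qed
    have rhs: "?U' +\<^sub>M Idl\<^bsub>R\<^esub> S \<star> carrier M = U +\<^sub>M ?q \<star> carrier M"
      unfolding q_times[OF MM] by (rule sum_assoc[OF U yM SM])
    let ?V = "?U' +\<^sub>M Idl\<^bsub>R\<^esub> S \<star> ?N'"
    have V: "sub ?V"
      by (rule sub_sum_closed[OF U' SN'])
    have yMV: "y \<cdot> carrier M \<subseteq> ?V"
      using sum_upper2[OF U yM] sum_upper1[OF U' SN'] by blast
    have NV: "N +\<^sub>M ?V = ?N'"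
    proof (rule subset_antisym)
      show "N +\<^sub>M ?V \<subseteq> ?N'"
        using UN by (intro sum_least[OF N'] cut_upper[OF yR N] sum_mono order_refl
            times_subset[OF N'] Idl_subset_carrier S(2))
      show "?N' \<subseteq> N +\<^sub>M ?V"
        by (rule sum_mono[OF order_refl yMV])
    qed
    \<comment> \<open>So \<open>N/(U + \<qq>N)\<close> is a quotient of \<open>N/(N \<inter> V)\<close>, which is isomorphic to \<open>(N + yM)/V\<close>.\<close>
    have "N \<inter> ?V \<subseteq> U +\<^sub>M ?q \<star> N"
    proof -
      let ?W = "U +\<^sub>M Idl\<^bsub>R\<^esub> S \<star> N"
      have W: "sub ?W"
        by (rule sub_sum_closed[OF U SN])
      have WN: "?W \<subseteq> N"
        using times_subset[OF N Idl_subset_carrier[OF S(2)]] UN by (rule sum_least[OF N, rotated])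
      have "Idl\<^bsub>R\<^esub> S \<star> ?N' \<subseteq> ?W +\<^sub>M y \<cdot> carrier M"
      proof (rule Idl_times_least[OF S(2) subD(1)[OF N'] sub_sum_closed[OF W yM]])
        fix a x assume a: "a \<in> S" and x: "x \<in> ?N'"
        obtain n m where nm: "n \<in> N" "m \<in> carrier M" "x = n \<oplus>\<^bsub>M\<^esub> y \<odot>\<^bsub>M\<^esub> m"
          using x by (rule mem_cutE)
        have aR: "a \<in> carrier R"
          using a S by blast
        have "a \<odot>\<^bsub>M\<^esub> x = a \<odot>\<^bsub>M\<^esub> n \<oplus>\<^bsub>M\<^esub> y \<odot>\<^bsub>M\<^esub> (a \<odot>\<^bsub>M\<^esub> m)"
          using nm aR yR subD(2)[OF N nm(1)] by (simp add: smult_r_distr smult_left_commute[of a y])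
        moreover have "a \<odot>\<^bsub>M\<^esub> n \<in> ?W"
          using times_mem[OF R.genideal_self[OF S(2), THEN subsetD, OF a] nm(1)] sum_upper2[OF U SN] by blast
        ultimately show "a \<odot>\<^bsub>M\<^esub> x \<in> ?W +\<^sub>M y \<cdot> carrier M"
          using aR nm(2) by (simp add: mem_cutI)
      qed
      moreover have "?U' \<subseteq> ?W +\<^sub>M y \<cdot> carrier M"
        by (intro sum_mono sum_upper1[OF U SN] order_refl)
      ultimately have "?V \<subseteq> ?W +\<^sub>M y \<cdot> carrier M"
        by (rule sum_least[OF sub_sum_closed[OF W yM], rotated])
      then have "N \<inter> ?V \<subseteq> (?W +\<^sub>M y \<cdot> carrier M) \<inter> N"
        by blast
      also have "\<dots> = ?W +\<^sub>M (y \<cdot> carrier M \<inter> N)"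
        by (rule modular_law[OF W yM N WN])
      also have "y \<cdot> carrier M \<inter> N = y \<cdot> N"
        by (rule inter_multiple_regular[OF N yR y(2)])
      also have "?W +\<^sub>M y \<cdot> N = U +\<^sub>M (y \<cdot> N +\<^sub>M Idl\<^bsub>R\<^esub> S \<star> N)"
        unfolding sum_commute[OF yN SN] by (rule sum_assoc[OF U SN yN])
      finally show ?thesis
        unfolding q_times[OF N] .
    qed
    then have "len (U +\<^sub>M ?q \<star> N) N \<le> len (N \<inter> ?V) N"
      by (rule interval_length_mono) simp
    also have "\<dots> \<le> len ?V ?N'"
      using length_second_iso[OF N V] unfolding NV .
    also note IH[unfolded rhs]
    finally show ?thesis .
  qed simp
qed

end


section \<open>Quotient modules and submodules as modules\<close>

lemma module_length_eq_interval_length: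
  "module_length R Q = interval_length R Q {} UNIV"
  by (simp add: module_length_def interval_length_def has_chain_def)

context module
begin

lemma submoduleI_smult:
  assumes "H \<subseteq> carrier M" "\<zero>\<^bsub>M\<^esub> \<in> H"
    and "\<And>a b. a \<in> H \<Longrightarrow> b \<in> H \<Longrightarrow> a \<oplus>\<^bsub>M\<^esub> b \<in> H"
    and smult: "\<And>a x. a \<in> carrier R \<Longrightarrow> x \<in> H \<Longrightarrow> a \<odot>\<^bsub>M\<^esub> x \<in> H"
  shows "sub H"
proof (rule submoduleI)
  show "\<ominus>\<^bsub>M\<^esub> a \<in> H" if a: "a \<in> H" for a
  proof -
    have "\<ominus>\<^bsub>M\<^esub> a = (\<ominus>\<^bsub>R\<^esub> \<one>\<^bsub>R\<^esub>) \<odot>\<^bsub>M\<^esub> a"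
      using a assms(1) by (simp add: smult_l_minus subsetD)
    then show ?thesis
      using smult[OF _ a, of "\<ominus>\<^bsub>R\<^esub> \<one>\<^bsub>R\<^esub>"] by simp
  qed
qed (fact assms)+

lemma submodule_restrict_iff:
  assumes N: "sub N"
  shows "submodule H R (M\<lparr>carrier := N\<rparr>) \<longleftrightarrow> sub H \<and> H \<subseteq> N"
proof -
  have mod: "module R (M\<lparr>carrier := N\<rparr>)"
    by (rule submodule.submodule_is_module[OF N module_axioms])
  show ?thesis
  proof (intro iffI conjI)
    assume H: "submodule H R (M\<lparr>carrier := N\<rparr>)"
    show HN: "H \<subseteq> N"
      using module.subD(1)[OF mod H] by simp
    show "sub H"
    proof (rule submoduleI_smult)
      show "H \<subseteq> carrier M"
        using HN subD(1)[OF N] by simp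
    qed (use module.subD(3,5,6)[OF mod H] in simp_all)
  next
    assume H: "sub H \<and> H \<subseteq> N"
    show "submodule H R (M\<lparr>carrier := N\<rparr>)"
      by (rule module.submoduleI_smult[OF mod]) (use H subD(3,5,6)[of H] in simp_all)
  qed
qed

lemma ideal_smult_restrict:
  assumes N: "sub N" and I: "I \<subseteq> carrier R"
  shows "ideal_smult R I (M\<lparr>carrier := N\<rparr>) = I \<star> N"
proof (rule subset_antisym)
  let ?S = "{a \<odot>\<^bsub>M\<^esub> x | a x. a \<in> I \<and> x \<in> N}"
  have eq: "ideal_smult R I (M\<lparr>carrier := N\<rparr>) = \<Inter> {H. (sub H \<and> H \<subseteq> N) \<and> ?S \<subseteq> H}"
    unfolding ideal_smult_def submodule_span_def submodule_restrict_iff[OF N] by simp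
  have "sub (I \<star> N)" "I \<star> N \<subseteq> N" "?S \<subseteq> I \<star> N"
    using times_sub[OF I subD(1)[OF N]] times_subset[OF N I] times_mem by auto
  then show "ideal_smult R I (M\<lparr>carrier := N\<rparr>) \<subseteq> I \<star> N"
    unfolding eq by blast
  show "I \<star> N \<subseteq> ideal_smult R I (M\<lparr>carrier := N\<rparr>)"
    unfolding eq ideal_times_def submodule_span_def by blast
qed

lemma ideal_smult_eq_times: "ideal_smult R I M = I \<star> carrier M"
  unfolding ideal_smult_def ideal_times_def ..

lemma interval_length_restrict_le:
  assumes N: "sub N"
  shows "interval_length R (M\<lparr>carrier := N\<rparr>) A B \<le> len A B"
  by (rule interval_length_transfer[where f = "\<lambda>C. C"]) (simp_all add: submodule_restrict_iff[OF N])

end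

text \<open>
Comparison of the module \<open>M/V\<close>, whose elements are cosets, with the submodules of \<open>M\<close> that contain \<open>V\<close>.
\<close>

locale quotient_context = module R M for R (structure) and M +
  fixes V
  assumes V: "submodule V R M"
begin

abbreviation proj where "proj m \<equiv> V +>\<^bsub>M\<^esub> m"

abbreviation Q where "Q \<equiv> quotient_module M V"

sublocale V: abelian_subgroup V M
  by (rule quotient_abelian_subgroup[OF V])

sublocale Q: module R Q
  by (rule quotient_module_is_module[OF V])

lemma carrier_Q: "carrier Q = proj ` carrier M"
  by (auto simp: quotient_module_def A_RCOSETS_def')

lemma proj_add: "x \<in> carrier M \<Longrightarrow> y \<in> carrier M \<Longrightarrow> proj x \<oplus>\<^bsub>Q\<^esub> proj y = proj (x \<oplus>\<^bsub>M\<^esub> y)"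
  using V.a_rcos_sum by (simp add: quotient_module_def)

lemma proj_smult: "a \<in> carrier R \<Longrightarrow> x \<in> carrier M \<Longrightarrow> a \<odot>\<^bsub>Q\<^esub> proj x = proj (a \<odot>\<^bsub>M\<^esub> x)"
  by (rule quotient_smult_coset[OF V])

lemma zero_Q: "\<zero>\<^bsub>Q\<^esub> = V"
  by (simp add: quotient_module_def)

lemma proj_mem: "v \<in> V \<Longrightarrow> proj v = V"
  by (rule V.a_rcos_const)

lemma mem_of_proj_mem:
  assumes C: "sub C" "V \<subseteq> C" and m: "m \<in> carrier M" "proj m \<in> proj ` C"
  shows "m \<in> C"
proof -
  obtain c where c: "c \<in> C" "proj m = proj c"
    using m(2) by blast
  have "m \<in> proj c"
    using V.a_rcos_self[OF m(1)] c(2) by simp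
  then obtain v where "v \<in> V" "m = v \<oplus>\<^bsub>M\<^esub> c"
    by (auto simp: a_r_coset_def')
  then show ?thesis
    using C c(1) subD(5)[OF C(1)] by blast
qed

lemma image_sub:
  assumes C: "sub C"
  shows "submodule (proj ` C) R Q"
proof (rule Q.submoduleI_smult)
  note cl = subD(2)[OF C]
  show "proj ` C \<subseteq> carrier Q"
    using subD(1)[OF C] unfolding carrier_Q by blast
  show "\<zero>\<^bsub>Q\<^esub> \<in> proj ` C"
    unfolding zero_Q using proj_mem[OF subD(3)[OF V]] subD(3)[OF C] by (metis image_eqI)
  show "a \<oplus>\<^bsub>Q\<^esub> b \<in> proj ` C" if ab: "a \<in> proj ` C" "b \<in> proj ` C" for a b
  proof -
    obtain x y where "x \<in> C" "y \<in> C" "a = proj x" "b = proj y"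
      using ab by blast
    then show ?thesis
      using cl by (simp add: proj_add subD(5)[OF C])
  qed
  show "a \<odot>\<^bsub>Q\<^esub> x \<in> proj ` C" if a: "a \<in> carrier R" "x \<in> proj ` C" for a x
  proof -
    obtain y where "y \<in> C" "x = proj y"
      using a(2) by blast
    then show ?thesis
      using a(1) cl by (simp add: proj_smult subD(6)[OF C])
  qed
qed

lemma vimage_sub:
  assumes D: "submodule D R Q"
  shows "sub {m \<in> carrier M. proj m \<in> D}" "V \<subseteq> {m \<in> carrier M. proj m \<in> D}"
proof -
  show V': "V \<subseteq> {m \<in> carrier M. proj m \<in> D}"
    using subD(1)[OF V] proj_mem Q.subD(3)[OF D] unfolding zero_Q by auto
  show "sub {m \<in> carrier M. proj m \<in> D}"
  proof (rule submoduleI_smult)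
    show "\<zero>\<^bsub>M\<^esub> \<in> {m \<in> carrier M. proj m \<in> D}"
      using V' subD(3)[OF V] by blast
    show "a \<oplus>\<^bsub>M\<^esub> b \<in> {m \<in> carrier M. proj m \<in> D}"
      if "a \<in> {m \<in> carrier M. proj m \<in> D}" "b \<in> {m \<in> carrier M. proj m \<in> D}" for a b
      using that Q.subD(5)[OF D, of "proj a" "proj b"] by (simp add: proj_add)
    show "a \<odot>\<^bsub>M\<^esub> x \<in> {m \<in> carrier M. proj m \<in> D}"
      if "a \<in> carrier R" "x \<in> {m \<in> carrier M. proj m \<in> D}" for a x
      using that Q.subD(6)[OF D, of a "proj x"] by (simp add: proj_smult)
  qed blast
qed

proposition quotient_module_length: "module_length R Q = len V (carrier M)"
proof (rule order_antisym)
  show "module_length R Q \<le> len V (carrier M)"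
    unfolding module_length_eq_interval_length
  proof (rule interval_length_transfer[where f = "\<lambda>D. {m \<in> carrier M. proj m \<in> D}"])
    fix D assume "submodule D R Q"
    then show "sub {m \<in> carrier M. proj m \<in> D} \<and> V \<subseteq> {m \<in> carrier M. proj m \<in> D} \<and>
        {m \<in> carrier M. proj m \<in> D} \<subseteq> carrier M"
      using vimage_sub by blast
  next
    fix D D' assume D: "submodule D R Q" "submodule D' R Q" "D \<subset> D'"
    obtain z where z: "z \<in> D'" "z \<notin> D"
      using D(3) by blast
    then obtain m where "m \<in> carrier M" "z = proj m"
      using Q.subD(2)[OF D(2)] unfolding carrier_Q by blast
    then show "{m \<in> carrier M. proj m \<in> D} \<subset> {m \<in> carrier M. proj m \<in> D'}"
      using z D(3) by blast
  qed
  show "len V (carrier M) \<le> module_length R Q"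
    unfolding module_length_eq_interval_length
  proof (rule interval_length_transfer[where f = "\<lambda>C. proj ` C"])
    fix C assume "sub C"
    then show "submodule (proj ` C) R Q \<and> {} \<subseteq> proj ` C \<and> proj ` C \<subseteq> UNIV"
      using image_sub by blast
  next
    fix C D assume CD: "sub C" "sub D" "V \<subseteq> C" "C \<subset> D"
    obtain m where m: "m \<in> D" "m \<notin> C"
      using CD(4) by blast
    have "proj m \<notin> proj ` C"
      using mem_of_proj_mem[OF CD(1,3)] m subD(2)[OF CD(2)] by blast
    then show "proj ` C \<subset> proj ` D"
      using m CD(4) by blast
  qed
qed

lemma proj_mem_ideal_smult_iff:
  assumes J: "J \<subseteq> carrier R" and m: "m \<in> carrier M"
  shows "proj m \<in> ideal_smult R J Q \<longleftrightarrow> m \<in> V +\<^sub>M J \<star> carrier M"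
proof
  have JM: "sub (J \<star> carrier M)"
    by (rule times_sub[OF J order_refl])
  have C: "sub (V +\<^sub>M J \<star> carrier M)" "V \<subseteq> V +\<^sub>M J \<star> carrier M"
    by (rule sub_sum_closed[OF V JM], rule sum_upper1[OF V JM])
  have JQ: "submodule (ideal_smult R J Q) R Q"
    unfolding Q.ideal_smult_eq_times by (rule Q.times_sub[OF J order_refl])
  have "ideal_smult R J Q \<subseteq> proj ` (V +\<^sub>M J \<star> carrier M)"
    unfolding Q.ideal_smult_eq_times
  proof (rule Q.times_least[OF image_sub[OF C(1)]])
    fix a z assume a: "a \<in> J" and "z \<in> carrier Q"
    then obtain x where x: "x \<in> carrier M" "z = proj x"
      unfolding carrier_Q by blast
    have "a \<odot>\<^bsub>M\<^esub> x \<in> V +\<^sub>M J \<star> carrier M"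
      using times_mem[OF a x(1)] sum_upper2[OF V JM] by blast
    then show "a \<odot>\<^bsub>Q\<^esub> z \<in> proj ` (V +\<^sub>M J \<star> carrier M)"
      using a J x by (auto simp: proj_smult)
  qed
  then show "m \<in> V +\<^sub>M J \<star> carrier M" if "proj m \<in> ideal_smult R J Q"
    using mem_of_proj_mem[OF C m] that by blast
  have "V +\<^sub>M J \<star> carrier M \<subseteq> {m \<in> carrier M. proj m \<in> ideal_smult R J Q}"
  proof (intro sum_least times_least vimage_sub[OF JQ])
    fix a x assume ax: "a \<in> J" "x \<in> carrier M"
    then have "a \<odot>\<^bsub>Q\<^esub> proj x \<in> ideal_smult R J Q"
      unfolding Q.ideal_smult_eq_times carrier_Q by (intro Q.times_mem imageI)
    then show "a \<odot>\<^bsub>M\<^esub> x \<in> {m \<in> carrier M. proj m \<in> ideal_smult R J Q}"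
      using ax J by (auto simp: proj_smult)
  qed
  then show "proj m \<in> ideal_smult R J Q" if "m \<in> V +\<^sub>M J \<star> carrier M"
    using that by blast
qed

text \<open>
Translates one condition of a regular sequence on \<open>M/V\<close>, which speaks of the iterated quotient
\<open>(M/V)/J(M/V)\<close>, into a statement about submodules of \<open>M\<close>.
\<close>

lemma regular_mod_of_quotient:
  assumes J: "J \<subseteq> carrier R" and x: "x \<in> carrier R"
    and reg: "\<And>z. z \<in> carrier (quotient_module Q (ideal_smult R J Q)) \<Longrightarrow>
      x \<odot>\<^bsub>quotient_module Q (ideal_smult R J Q)\<^esub> z = \<zero>\<^bsub>quotient_module Q (ideal_smult R J Q)\<^esub> \<Longrightarrow>
      z = \<zero>\<^bsub>quotient_module Q (ideal_smult R J Q)\<^esub>"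
  shows "regular_mod x (V +\<^sub>M J \<star> carrier M)"
  unfolding regular_mod_def
proof (intro ballI impI)
  fix m assume m: "m \<in> carrier M" "x \<odot>\<^bsub>M\<^esub> m \<in> V +\<^sub>M J \<star> carrier M"
  let ?JQ = "ideal_smult R J Q"
  have JQ: "submodule ?JQ R Q"
    unfolding Q.ideal_smult_eq_times by (rule Q.times_sub[OF J order_refl])
  interpret L: quotient_context R Q ?JQ
    by (intro quotient_context.intro quotient_context_axioms.intro Q.module_axioms JQ)
  have pm: "proj m \<in> carrier Q"
    using m(1) unfolding carrier_Q by blast
  have "x \<odot>\<^bsub>Q\<^esub> proj m \<in> ?JQ"
    using m x by (simp add: proj_smult proj_mem_ideal_smult_iff[OF J])
  then have "x \<odot>\<^bsub>L.Q\<^esub> L.proj (proj m) = \<zero>\<^bsub>L.Q\<^esub>"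
    unfolding L.proj_smult[OF x pm] L.zero_Q by (rule L.proj_mem)
  then have "L.proj (proj m) = ?JQ"
    using reg[of "L.proj (proj m)"] pm unfolding L.carrier_Q L.zero_Q by blast
  then have "proj m \<in> ?JQ"
    using L.V.a_rcos_self[OF pm] by simp
  then show "m \<in> V +\<^sub>M J \<star> carrier M"
    by (simp add: proj_mem_ideal_smult_iff[OF J m(1)])
qed

end

section \<open>From depth to deep submodules\<close>

context module
begin

lemma deep_Suc: "deep I (Suc r) K \<Longrightarrow> deep I r K"
proof (induction r arbitrary: K)
  case (Suc r)
  then show ?case
    by (simp only: deep.simps) blast
qed simp

lemma deep_antimono: "deep I n K \<Longrightarrow> r \<le> n \<Longrightarrow> deep I r K"
proof (induction n)
  case (Suc n)
  then show ?case
    using deep_Suc le_Suc_eq by blast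
qed simp

lemma deep_carrier:
  assumes "I \<subseteq> carrier R"
  shows "deep I r (carrier M)"
proof (induction r)
  case (Suc r)
  have "cut y (carrier M) = carrier M" if "y \<in> I" for y
    using that assms by (intro sum_absorb carrier_is_submodule multiple_sub multiple_subset) auto
  then show ?case
    using Suc by (simp add: no_socle_def)
qed simp

lemma deep_of_regular_list:
  assumes R: "noetherian_ring R" and mc: maximal_condition and I: "ideal I R"
  shows "sub K \<Longrightarrow> set xs \<subseteq> I \<Longrightarrow>
    (\<And>i. i < length xs \<Longrightarrow> regular_mod (xs ! i) (K +\<^sub>M Idl\<^bsub>R\<^esub> (set (take i xs)) \<star> carrier M)) \<Longrightarrow>
    deep I (length xs) K"
proof (induction xs arbitrary: K)
  case (Cons x xs)
  note K = \<open>sub K\<close>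
  have MM: "sub (carrier M)"
    by (rule carrier_is_submodule)
  have IR: "I \<subseteq> carrier R"
    using ideal.Icarr[OF I] by blast
  have x: "x \<in> I" "x \<in> carrier R" and xs: "set xs \<subseteq> I" "set xs \<subseteq> carrier R"
    using Cons.prems(2) IR by auto
  have xM: "sub (x \<cdot> carrier M)"
    by (rule multiple_sub[OF x(2) MM])
  have "K +\<^sub>M {\<zero>\<^bsub>M\<^esub>} = K"
    using subD(3)[OF K] by (intro sum_absorb[OF K zero_sub]) simp
  then have reg: "regular_mod x K"
    using Cons.prems(3)[of 0] Idl_empty_times[OF MM] by simp
  have "deep I (length xs) (cut x K)"
  proof (rule Cons.IH[OF cut_sub[OF x(2) K] xs(1)])
    fix i assume i: "i < length xs"
    have S: "set (take i xs) \<subseteq> carrier R"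
      using xs(2) set_take_subset by fastforce
    have "cut x K +\<^sub>M Idl\<^bsub>R\<^esub> (set (take i xs)) \<star> carrier M =
        K +\<^sub>M Idl\<^bsub>R\<^esub> (insert x (set (take i xs))) \<star> carrier M"
      unfolding Idl_insert_times[OF x(2) S MM] by (rule sum_assoc[OF K xM Idl_times_sub[OF S MM]])
    then show "regular_mod (xs ! i) (cut x K +\<^sub>M Idl\<^bsub>R\<^esub> (set (take i xs)) \<star> carrier M)"
      using Cons.prems(3)[of "Suc i"] i by simp
  qed
  then show ?case
    using deep_of_regular[OF R mc I K x(1) reg] by simp
qed simp

text \<open>
If \<open>\<mm>\<close> times \<open>M/N\<close> is all of \<open>M/N\<close>, the depth is infinite; then \<open>N = M\<close> by Nakayama's lemma, and the zero module
is deep of every order. Otherwise the supremum yields a regular sequence of length at least \<open>r\<close>.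
\<close>

lemma deep_of_depth:
  assumes R: "noetherian_ring R" and mc: maximal_condition and loc: "local_ring \<mm> R"
    and N: "sub N" and depth: "enat r \<le> depth R \<mm> (quotient_module M N)"
  shows "deep \<mm> r N"
proof -
  interpret local_ring \<mm> R
    by fact
  interpret N: quotient_context R M N
    by (intro quotient_context.intro quotient_context_axioms.intro module_axioms N)
  have mR: "\<mm> \<subseteq> carrier R"
    using a_Hcarr by blast
  have MM: "sub (carrier M)"
    by (rule carrier_is_submodule)
  show ?thesis
  proof (cases "ideal_smult R \<mm> N.Q = carrier N.Q")
    case True
    have mM: "sub (\<mm> \<star> carrier M)"
      by (rule times_sub[OF mR order_refl])
    have "\<one>\<^bsub>R\<^esub> \<cdot> carrier M \<subseteq> \<mm> \<star> carrier M +\<^sub>M N"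
    proof
      fix z assume "z \<in> \<one>\<^bsub>R\<^esub> \<cdot> carrier M"
      then have z: "z \<in> carrier M"
        by auto
      then have "N.proj z \<in> ideal_smult R \<mm> N.Q"
        unfolding True N.carrier_Q by blast
      then show "z \<in> \<mm> \<star> carrier M +\<^sub>M N"
        unfolding N.proj_mem_ideal_smult_iff[OF mR z] sum_commute[OF mM N] .
    qed
    moreover have "\<one>\<^bsub>R\<^esub> \<notin> \<mm>"
      using one_imp_carrier I_notcarr by blast
    moreover have "primeideal \<mm> R"
      by (rule R.maximalideal_prime[OF is_maximalideal])
    ultimately obtain t where t: "t \<in> carrier R" "t \<notin> \<mm>" "t \<cdot> carrier M \<subseteq> N"
      using nakayama_at_prime[OF mc _ MM N R.one_closed] by blast
    have "carrier M \<subseteq> N"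
      using mem_of_multiple_mem[OF R loc N t(1,2)] t(3) by blast
    then have "N = carrier M"
      using subD(1)[OF N] by blast
    then show ?thesis
      using deep_carrier[OF mR] by simp
  next
    case False
    show ?thesis
    proof (cases r)
      case (Suc k)
      have "enat k < Sup {enat (length xs) | xs. set xs \<subseteq> \<mm> \<and> regular_sequence R N.Q xs}"
        using depth False unfolding depth_def Suc by (simp add: Suc_ile_eq)
      then obtain xs where xs: "k < length xs" "set xs \<subseteq> \<mm>" "regular_sequence R N.Q xs"
        by (auto simp: less_Sup_iff)
      have "deep \<mm> (length xs) N"
      proof (rule deep_of_regular_list[OF R mc is_ideal N xs(2)])
        fix i assume i: "i < length xs"
        have S: "set (take i xs) \<subseteq> carrier R"
          using xs(2) mR set_take_subset by fastforce
        have xi: "xs ! i \<in> carrier R"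
          using i xs(2) mR nth_mem by blast
        show "regular_mod (xs ! i) (N +\<^sub>M Idl\<^bsub>R\<^esub> (set (take i xs)) \<star> carrier M)"
          by (rule N.regular_mod_of_quotient[OF Idl_subset_carrier[OF S] xi])
            (use xs(3) i in \<open>simp add: regular_sequence_def Let_def\<close>)
      qed
      then show ?thesis
        using deep_antimono xs(1) Suc by (metis Suc_leI)
    qed simp
  qed
qed

end

theorem theorem3:
  fixes R :: "('a, 'r) ring_scheme"
    and \<mm> \<qq> :: "'a set"
    and M :: "('a, 'b, 'm) module_scheme"
    and N :: "'b set"
    and d :: nat
  assumes "noetherian_ring R"
    and "local_ring \<mm> R"
    and "module R M"
    and "finitely_generated_module R M"
    and "module_dim R M = enat d"
    and "d \<ge> 1"
    and "submodule N R M"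
    and "depth R \<mm> (quotient_module M N) \<ge> enat (d - 1)"
    and "\<exists>xs. system_of_parameters R \<mm> M xs \<and> \<qq> = Idl\<^bsub>R\<^esub> (set xs)"
  shows "module_length R (quotient_module (M\<lparr>carrier := N\<rparr>) (ideal_smult R \<qq> (M\<lparr>carrier := N\<rparr>)))
    \<le> module_length R (quotient_module M (ideal_smult R \<qq> M))"
proof -
  interpret module R M
    by fact
  have mc: maximal_condition
    by (rule finitely_generated_maximal_condition) fact+
  have N: "sub N"
    by fact
  obtain xs where xs: "set xs \<subseteq> \<mm>" "length xs = d" and q: "\<qq> = Idl\<^bsub>R\<^esub> (set xs)"
    using assms(5,9) unfolding system_of_parameters_def by auto
  have xsR: "set xs \<subseteq> carrier R"
  proof -
    interpret local_ring \<mm> R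
      by fact
    show ?thesis
      using xs(1) a_Hcarr by blast
  qed
  have qR: "\<qq> \<subseteq> carrier R"
    unfolding q by (rule Idl_subset_carrier[OF xsR])
  have deep: "deep \<mm> (d - 1) N"
    by (rule deep_of_depth) fact+
  have qN: "sub (\<qq> \<star> N)" and qM: "sub (\<qq> \<star> carrier M)"
    by (rule times_sub[OF qR subD(1)[OF N]], rule times_sub[OF qR order_refl])
  have zero_add: "{\<zero>\<^bsub>M\<^esub>} +\<^sub>M X = X" if "sub X" for X
    unfolding sum_commute[OF zero_sub that] using subD(3)[OF that]
    by (intro sum_absorb[OF that zero_sub]) simp
  have "len ({\<zero>\<^bsub>M\<^esub>} +\<^sub>M \<qq> \<star> N) N \<le> len ({\<zero>\<^bsub>M\<^esub>} +\<^sub>M \<qq> \<star> carrier M) (carrier M)"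
    unfolding q
  proof (rule length_mod_parameters[OF assms(1) mc assms(2) xs(1) _ zero_sub N _ deep])
    show "length xs = Suc (d - 1)"
      using xs(2) assms(6) by simp
    show "{\<zero>\<^bsub>M\<^esub>} \<subseteq> N"
      using subD(3)[OF N] by simp
  qed
  then have main: "len (\<qq> \<star> N) N \<le> len (\<qq> \<star> carrier M) (carrier M)"
    unfolding zero_add[OF qN] zero_add[OF qM] .
  interpret NN: quotient_context R "M\<lparr>carrier := N\<rparr>" "\<qq> \<star> N"
  proof (intro quotient_context.intro quotient_context_axioms.intro)
    show "module R (M\<lparr>carrier := N\<rparr>)"
      by (rule submodule.submodule_is_module[OF N]) fact
    show "submodule (\<qq> \<star> N) R (M\<lparr>carrier := N\<rparr>)"
      unfolding submodule_restrict_iff[OF N] using qN times_subset[OF N qR] by blast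
  qed
  interpret MM: quotient_context R M "\<qq> \<star> carrier M"
    by (intro quotient_context.intro quotient_context_axioms.intro module_axioms qM)
  have "module_length R NN.Q \<le> len (\<qq> \<star> N) N"
    unfolding NN.quotient_module_length using interval_length_restrict_le[OF N] by simp
  also note main
  also have "len (\<qq> \<star> carrier M) (carrier M) = module_length R MM.Q"
    by (rule MM.quotient_module_length[symmetric])
  finally show ?thesis
    unfolding ideal_smult_restrict[OF N qR] ideal_smult_eq_times .
qed

end
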